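(* (1) There are cube faces $F^1,F^2,F^3$ (each a face of $[0,1]^{\mathcal{I}_{p,q}}$ for some suitable integers $p\ge q\ge 2$, which may be different for each of (a), (b), (c)) with the following properties: (a) $\mathrm{Fix}_{F^1}(\mathcal{S}_{\mathrm{SCI}})\subsetneq\mathrm{Fix}_{F^1}(\mathcal{S}_{\mathrm{CI}})$; (b) $\mathrm{Fix}^{\mathrm{aff}(\mathrm{O}^{=}_{p,q})}_{F^2}(\mathcal{S}_{\mathrm{CI}})\subsetneq\mathrm{Fix}_{F^2}(\mathcal{S}_{\mathrm{SCI}})$; (c) $\mathrm{Fix}^{\mathrm{aff}(\mathrm{O}^{=}_{p,q})}_{F^3}(\mathcal{S}_{\mathrm{SCI}})\subsetneq\mathrm{Fix}^{\mathrm{aff}(\mathrm{O}^{=}_{p,q})}_{F^3}(\mathcal{S}_{\mathrm{CI}})$. (2) For all integers $p\ge q\ge 2$ and all faces $F$ of the cube $[0,1]^{\mathcal{I}_{p,q}}$, we have $$\mathrm{Fix}^{\mathrm{aff}(\mathrm{O}^{=}_{p,q})}_{F}(\mathcal{S}_{\mathrm{SCI}})=\mathrm{Fix}_F(\mathrm{O}^{=}_{p,q}).$$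
   Context: Notation: $[n]=\{1,\dots,n\}$. For integers $p\ge q\ge 2$ let $q(i)=\min\{i,q\}$, $\mathcal{I}_{p,q}=\{(i,j)\in[p]\times[q]: i\ge j\}$ and $\mathrm{row}_i=\{(i,j): j\in[q(i)]\}$. For $A\subseteq\mathcal{I}_{p,q}$ and $x\in\mathbb{R}^{\mathcal{I}_{p,q}}$ write $x(A)=\sum_{(i,j)\in A}x_{ij}$. Partitioning orbitope: $\mathrm{O}^{=}_{p,q}$ is the convex hull of all 0/1-matrices $x\in\{0,1\}^{[p]\times[q]}$ with exactly one 1-entry per row whose columns are in non-increasing lexicographical order, i.e. $\sum_{i=1}^p 2^{p-i}x_{ij}\ge\sum_{i=1}^p 2^{p-i}x_{i,j+1}$ for all $j\in[q-1]$. Since all such matrices have $x_{ij}=0$ for $i<j$, these components are dropped and $\mathrm{O}^{=}_{p,q}\subseteq\mathbb{R}^{\mathcal{I}_{p,q}}$. $\mathrm{aff}(\cdot)$ denotes the affine hull. Shifted column inequalities: for $j\in[q]$ and $1\le\eta\le p-j+1$ put $\langle\eta,j\rangle=(j+\eta-1,j)\in\mathcal{I}_{p,q}$. A set $S=\{\langle1,c_1\rangle,\langle2,c_2\rangle,\dots,\langle\eta,c_\eta\rangle\}\subset\mathcal{I}_{p,q}$ with $\eta\ge1$ and $c_1\le c_2\le\dots\le c_\eta$ is a shifted column. For $(i,j)=\langle\eta,j\rangle\in\mathcal{I}_{p,q}$, a shifted column $S=\{\langle1,c_1\rangle,\langle2,c_2\rangle,\dots,\langle\eta,c_\eta\rangle\}$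 (with the same $\eta$, and $c_1\le c_2\le\dots\le c_\eta$) with $c_\eta<j$, and $B=\{(i,j),(i,j+1),\dots,(i,q(i))\}$, the inequality $x(B)-x(S)\le0$ is a shifted column inequality. If $c_1=\dots=c_\eta=j-1$, it is a column inequality. Systems: $\mathcal{S}_{\mathrm{SCI}}$ is the system consisting of the non-negativity inequalities $x_{ij}\ge0$ ($(i,j)\in\mathcal{I}_{p,q}$), the row-sum equations $x(\mathrm{row}_i)=1$ ($i\in[p]$; each written as two inequalities), and all shifted column inequalities. $\mathcal{S}_{\mathrm{CI}}$ is the subsystem consisting of the non-negativity inequalities, the row-sum equations, and only the column inequalities. Fixing: let $C=[0,1]^{\mathcal{I}_{p,q}}$, let $F$ be a face of $C$. For a polytope $P\subseteq C$, $\mathrm{Fix}_F(P)$ is the smallest face of $C$ containing $P\cap F\cap\{0,1\}^{\mathcal{I}_{p,q}}$ (the empty face if this set is empty). For a system $\mathcal{S}$ of inequalities $a_r^Tx\le b_r$, $r\in[m]$, let $P_r=\{x\in C: a_r^Tx\le b_r\}$. Then: - $\mathrm{Fix}_F(\mathcal{S})$ is the face $G$ of $C$ obtained by starting with $G:=F$ and iteratively replacing $G$ by $\mathrm{Fix}_G(P_r)$ as long as there is some $r\in[m]$ with $\mathrm{Fix}_G(P_r)\subsetneq G$ (the result is independent of the choices). - For an affine subspace $T$ of $\mathbb{R}^{\mathcal{I}_{p,q}}$ containing $\{x\in C: x\text{ satisfies }\mathcal{S}\}$, let $\mathrm{Fix}^{T}_{G}(P_r)$ be the smallest face of $C$ containing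 $P_r\cap T\cap\{0,1\}^{\mathcal{I}_{p,q}}\cap G$. Then $\mathrm{Fix}^{T}_F(\mathcal{S})$ is the face $G$ of $C$ obtained by starting with $G:=F$ and iteratively replacing $G$ by $\mathrm{Fix}^{T}_G(P_r)$ as long as there is some $r\in[m]$ with $\mathrm{Fix}^{T}_G(P_r)\subsetneq G$. *)

theory Defs
  imports "HOL-Analysis.Analysis" "HOL-Analysis.Finite_Function_Topology"
begin

text \<open>
  A point of the space of real vectors indexed by a finite set \<open>I\<close> of pairs is a finitely
  supported function from \<open>nat \<times> nat\<close> to \<open>real\<close> whose support lies in \<open>I\<close>. This type is a real vector
  space, so the library's \<open>convex hull\<close>, \<open>affine hull\<close> and \<open>face_of\<close> apply, while
  \<open>p\<close> and \<open>q\<close> remain ordinary variables.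
\<close>

type_synonym point = "(nat \<times> nat, real) poly_mapping"

abbreviation entry :: "point \<Rightarrow> nat \<times> nat \<Rightarrow> real"
  where "entry \<equiv> Poly_Mapping.lookup"

definition index_set :: "nat \<Rightarrow> nat \<Rightarrow> (nat \<times> nat) set"
  where "index_set p q = {(i, j). i \<in> {1..p} \<and> j \<in> {1..q} \<and> j \<le> i}"

definition row :: "nat \<Rightarrow> nat \<Rightarrow> (nat \<times> nat) set"
  where "row q i = {i} \<times> {1..min i q}"

definition cube :: "nat \<Rightarrow> nat \<Rightarrow> point set"
  where "cube p q = {x. Poly_Mapping.keys x \<subseteq> index_set p q \<and>
    (\<forall>e\<in>index_set p q. 0 \<le> entry x e \<and> entry x e \<le> 1)}"

definition zero_one_points :: "nat \<Rightarrow> nat \<Rightarrow> point set"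
  where "zero_one_points p q = {x. Poly_Mapping.keys x \<subseteq> index_set p q \<and>
    (\<forall>e\<in>index_set p q. entry x e \<in> {0, 1})}"


subsection \<open>The partitioning orbitope\<close>

text \<open>
  The matrices range over the full index set \<open>{1..p} \<times> {1..q}\<close>. Dropping the components
  with \<open>i < j\<close>, which all vanish (lemma \<open>orbitope_matrices_keys\<close>), is then the identity.
\<close>

definition orbitope_matrices :: "nat \<Rightarrow> nat \<Rightarrow> point set"
  where "orbitope_matrices p q = {x. Poly_Mapping.keys x \<subseteq> {1..p} \<times> {1..q} \<and>
    (\<forall>i\<in>{1..p}. \<forall>j\<in>{1..q}. entry x (i, j) \<in> {0, 1}) \<and>
    (\<forall>i\<in>{1..p}. \<exists>!j. j \<in> {1..q} \<and> entry x (i, j) = 1) \<and>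
    (\<forall>j\<in>{1..<q}. (\<Sum>i=1..p. 2 ^ (p - i) * entry x (i, j))
                 \<ge> (\<Sum>i=1..p. 2 ^ (p - i) * entry x (i, j + 1)))}"

definition orbitope :: "nat \<Rightarrow> nat \<Rightarrow> point set"
  where "orbitope p q = convex hull (orbitope_matrices p q)"


subsection \<open>Systems of linear inequalities\<close>

text \<open>The pair \<open>(a, b)\<close> stands for the inequality \<open>a\<^sup>T x \<le> b\<close>.\<close>

type_synonym ineq = "(nat \<times> nat \<Rightarrow> real) \<times> real"

definition solutions_in_cube :: "nat \<Rightarrow> nat \<Rightarrow> ineq \<Rightarrow> point set"
  where "solutions_in_cube p q = (\<lambda>(a, b).
    {x \<in> cube p q. (\<Sum>e\<in>index_set p q. a e * entry x e) \<le> b})"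

definition nonneg_ineqs :: "nat \<Rightarrow> nat \<Rightarrow> ineq set"
  where "nonneg_ineqs p q = {(\<lambda>e. - indicator {(i, j)} e, 0) | i j. (i, j) \<in> index_set p q}"

definition row_sum_ineqs :: "nat \<Rightarrow> nat \<Rightarrow> ineq set"
  where "row_sum_ineqs p q =
    {(\<lambda>e. indicator (row q i) e, 1) | i. i \<in> {1..p}} \<union>
    {(\<lambda>e. - indicator (row q i) e, - 1) | i. i \<in> {1..p}}"

definition diag_coord :: "nat \<Rightarrow> nat \<Rightarrow> nat \<times> nat"
  where "diag_coord \<eta> j = (j + \<eta> - 1, j)"

definition shifted_column :: "nat \<Rightarrow> nat \<Rightarrow> nat \<Rightarrow> (nat \<Rightarrow> nat) \<Rightarrow> (nat \<times> nat) set \<Rightarrow> bool"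
  where "shifted_column p q \<eta> c S \<longleftrightarrow>
    1 \<le> \<eta> \<and> mono_on {1..\<eta>} c \<and> S = (\<lambda>k. diag_coord k (c k)) ` {1..\<eta>} \<and> S \<subseteq> index_set p q"

definition bar :: "nat \<Rightarrow> nat \<Rightarrow> nat \<Rightarrow> (nat \<times> nat) set"
  where "bar q i j = {i} \<times> {j..min i q}"

definition shifted_column_ineqs :: "nat \<Rightarrow> nat \<Rightarrow> ineq set"
  where "shifted_column_ineqs p q =
    {(\<lambda>e. indicator (bar q i j) e - indicator S e, 0) | i j \<eta> c S.
       (i, j) \<in> index_set p q \<and> (i, j) = diag_coord \<eta> j \<and> shifted_column p q \<eta> c S \<and> c \<eta> < j}"

definition column_ineqs :: "nat \<Rightarrow> nat \<Rightarrow> ineq set"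
  where "column_ineqs p q =
    {(\<lambda>e. indicator (bar q i j) e - indicator S e, 0) | i j \<eta> c S.
       (i, j) \<in> index_set p q \<and> (i, j) = diag_coord \<eta> j \<and> shifted_column p q \<eta> c S \<and> c \<eta> < j \<and>
       (\<forall>k\<in>{1..\<eta>}. c k = j - 1)}"

definition SCI_system :: "nat \<Rightarrow> nat \<Rightarrow> ineq set"
  where "SCI_system p q = nonneg_ineqs p q \<union> row_sum_ineqs p q \<union> shifted_column_ineqs p q"

definition CI_system :: "nat \<Rightarrow> nat \<Rightarrow> ineq set"
  where "CI_system p q = nonneg_ineqs p q \<union> row_sum_ineqs p q \<union> column_ineqs p q"


subsection \<open>Fixing\<close>

text \<open>The empty set is a face of the cube, so \<open>smallest_face C {} = {}\<close>.\<close>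

definition smallest_face :: "'a::real_vector set \<Rightarrow> 'a set \<Rightarrow> 'a set"
  where "smallest_face C X = \<Inter>{G. G face_of C \<and> X \<subseteq> G}"

definition Fix :: "nat \<Rightarrow> nat \<Rightarrow> point set \<Rightarrow> point set \<Rightarrow> point set"
  where "Fix p q F P = smallest_face (cube p q) (P \<inter> F \<inter> zero_one_points p q)"

definition fix_step :: "nat \<Rightarrow> nat \<Rightarrow> point set set \<Rightarrow> point set \<Rightarrow> point set \<Rightarrow> bool"
  where "fix_step p q Ps G G' \<longleftrightarrow> (\<exists>P\<in>Ps. G' = Fix p q G P \<and> G' \<subset> G)"

text \<open>
  The iteration stops at exactly one face whatever choices are made (lemma \<open>fix_iter_unique\<close>),
  so the description below is proper.
\<close>

definition fix_iter :: "nat \<Rightarrow> nat \<Rightarrow> point set set \<Rightarrow> point set \<Rightarrow> point set"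
  where "fix_iter p q Ps F =
    (THE G. (fix_step p q Ps)\<^sup>*\<^sup>* F G \<and> \<not> (\<exists>G'. fix_step p q Ps G G'))"

definition Fix_system :: "nat \<Rightarrow> nat \<Rightarrow> point set \<Rightarrow> ineq set \<Rightarrow> point set"
  where "Fix_system p q F S = fix_iter p q (solutions_in_cube p q ` S) F"

definition Fix_system_aff :: "nat \<Rightarrow> nat \<Rightarrow> point set \<Rightarrow> point set \<Rightarrow> ineq set \<Rightarrow> point set"
  where "Fix_system_aff p q T F S = fix_iter p q ((\<lambda>r. solutions_in_cube p q r \<inter> T) ` S) F"


subsection \<open>Well-definedness\<close>

lemma lookup_scaleR: "entry (r *\<^sub>R x) k = r * entry x k"
proof -
  have "finite {i. r * entry x i \<noteq> 0}"
    by (rule finite_subset[OF _ finite_lookup[of x]]) auto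
  then show ?thesis by (simp add: scaleR_poly_mapping_def)
qed

lemma convex_cube: "convex (cube p q)"
proof (rule convexI)
  fix x y :: point and u v :: real
  assume x: "x \<in> cube p q" and y: "y \<in> cube p q" and uv: "0 \<le> u" "0 \<le> v" "u + v = 1"
  let ?z = "u *\<^sub>R x + v *\<^sub>R y"
  have e: "entry ?z k = u * entry x k + v * entry y k" for k
    by (simp add: lookup_add lookup_scaleR)
  have "Poly_Mapping.keys ?z \<subseteq> index_set p q"
  proof
    fix k assume "k \<in> Poly_Mapping.keys ?z"
    then have "entry x k \<noteq> 0 \<or> entry y k \<noteq> 0"
      using e[of k] by (auto simp: in_keys_iff)
    then show "k \<in> index_set p q"
      using x y by (auto simp: cube_def in_keys_iff)
  qed
  moreover have "0 \<le> entry ?z k \<and> entry ?z k \<le> 1" if "k \<in> index_set p q" for k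
  proof -
    have "0 \<le> entry x k" "entry x k \<le> 1" "0 \<le> entry y k" "entry y k \<le> 1"
      using x y that by (auto simp: cube_def)
    then show ?thesis
      using uv unfolding e by (simp add: convex_bound_le)
  qed
  ultimately show "?z \<in> cube p q" by (simp add: cube_def)
qed

lemma zero_one_subset_cube: "zero_one_points p q \<subseteq> cube p q"
  by (fastforce simp: zero_one_points_def cube_def)

lemma finite_index_set: "finite (index_set p q)"
  by (rule finite_subset[of _ "{1..p} \<times> {1..q}"]) (auto simp: index_set_def)

lemma finite_zero_one: "finite (zero_one_points p q)"
proof (rule inj_on_finite)
  show "Poly_Mapping.keys ` zero_one_points p q \<subseteq> Pow (index_set p q)"
    by (auto simp: zero_one_points_def)
  show "inj_on Poly_Mapping.keys (zero_one_points p q)"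
  proof (rule inj_onI, rule poly_mapping_eqI)
    fix x y k
    assume *: "x \<in> zero_one_points p q" "y \<in> zero_one_points p q"
      and k: "Poly_Mapping.keys x = Poly_Mapping.keys y"
    have "entry z k = (if k \<in> Poly_Mapping.keys z then 1 else 0)" if "z \<in> zero_one_points p q" for z
      using that by (auto simp: zero_one_points_def in_keys_iff)
    then show "entry x k = entry y k" using * k by simp
  qed
qed (simp add: finite_index_set)

lemma smallest_face_least: "G face_of C \<Longrightarrow> X \<subseteq> G \<Longrightarrow> smallest_face C X \<subseteq> G"
  by (auto simp: smallest_face_def)

lemma smallest_face_superset: "X \<subseteq> smallest_face C X"
  by (auto simp: smallest_face_def)

lemma smallest_face_mono: "X \<subseteq> Y \<Longrightarrow> smallest_face C X \<subseteq> smallest_face C Y"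
  by (auto simp: smallest_face_def)

lemma smallest_face_face_of: "convex C \<Longrightarrow> X \<subseteq> C \<Longrightarrow> smallest_face C X face_of C"
  unfolding smallest_face_def by (rule face_of_Inter) (auto intro: face_of_refl)

lemma Fix_face_of: "Fix p q F P face_of cube p q"
  unfolding Fix_def using zero_one_subset_cube
  by (intro smallest_face_face_of convex_cube) auto

lemma Fix_subset: "G face_of cube p q \<Longrightarrow> Fix p q G P \<subseteq> G"
  unfolding Fix_def by (rule smallest_face_least) auto

lemma Fix_mono: "G \<subseteq> H \<Longrightarrow> Fix p q G P \<subseteq> Fix p q H P"
  unfolding Fix_def by (rule smallest_face_mono) auto

lemma Fix_generated:
  "Fix p q F P = smallest_face (cube p q) (Fix p q F P \<inter> zero_one_points p q)"
proof
  have "P \<inter> F \<inter> zero_one_points p q \<subseteq> Fix p q F P"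
    unfolding Fix_def by (rule smallest_face_superset)
  then show "Fix p q F P \<subseteq> smallest_face (cube p q) (Fix p q F P \<inter> zero_one_points p q)"
    unfolding Fix_def[of p q F P] by (intro smallest_face_mono) auto
  show "smallest_face (cube p q) (Fix p q F P \<inter> zero_one_points p q) \<subseteq> Fix p q F P"
    by (rule smallest_face_least[OF Fix_face_of]) auto
qed

lemma fix_step_reachable_face:
  assumes "(fix_step p q Ps)\<^sup>*\<^sup>* F G" "F face_of cube p q"
  shows "G face_of cube p q"
  using assms by (induction rule: rtranclp_induct) (auto simp: fix_step_def Fix_face_of)

lemma fix_step_terminates_generated:
  assumes "G = smallest_face (cube p q) (G \<inter> zero_one_points p q)"
  shows "\<exists>H. (fix_step p q Ps)\<^sup>*\<^sup>* G H \<and> \<not> (\<exists>H'. fix_step p q Ps H H')"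
  using assms
proof (induction "card (G \<inter> zero_one_points p q)" arbitrary: G rule: less_induct)
  case less
  show ?case
  proof (cases "\<exists>G'. fix_step p q Ps G G'")
    case True
    then obtain G' where step: "fix_step p q Ps G G'" by blast
    then have gen: "G' = smallest_face (cube p q) (G' \<inter> zero_one_points p q)" and sub: "G' \<subset> G"
      using Fix_generated by (auto simp: fix_step_def)
    have "G' \<inter> zero_one_points p q \<noteq> G \<inter> zero_one_points p q"
      using gen less.prems sub by auto
    then have "card (G' \<inter> zero_one_points p q) < card (G \<inter> zero_one_points p q)"
      using sub by (intro psubset_card_mono) (auto simp: finite_zero_one)
    from less.hyps[OF this gen] show ?thesis
      using step by (meson converse_rtranclp_into_rtranclp)
  qed blast
qed

lemma fix_step_terminates:
  "\<exists>H. (fix_step p q Ps)\<^sup>*\<^sup>* G H \<and> \<not> (\<exists>H'. fix_step p q Ps H H')"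
proof (cases "\<exists>G'. fix_step p q Ps G G'")
  case True
  then obtain G' where step: "fix_step p q Ps G G'" by blast
  then have "G' = smallest_face (cube p q) (G' \<inter> zero_one_points p q)"
    using Fix_generated by (auto simp: fix_step_def)
  from fix_step_terminates_generated[OF this] show ?thesis
    using step by (meson converse_rtranclp_into_rtranclp)
qed blast

lemma fix_step_stuck_subset:
  assumes "(fix_step p q Ps)\<^sup>*\<^sup>* F G" "F face_of cube p q"
    and "(fix_step p q Ps)\<^sup>*\<^sup>* F H" and stuck: "\<not> (\<exists>H'. fix_step p q Ps H H')"
  shows "H \<subseteq> G"
proof -
  have H: "H face_of cube p q" using assms fix_step_reachable_face by blast
  have "H \<subseteq> F"
    using assms(3) by (induction rule: rtranclp_induct) (auto simp: fix_step_def)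
  with assms(1) show ?thesis
  proof (induction rule: rtranclp_induct)
    case (step G G')
    then obtain P where P: "P \<in> Ps" "G' = Fix p q G P" by (auto simp: fix_step_def)
    have "Fix p q H P = H"
      using stuck P(1) Fix_subset[OF H] by (auto simp: fix_step_def)
    then show ?case using Fix_mono step P by metis
  qed
qed

lemma fix_iter_unique:
  assumes "F face_of cube p q"
  shows "\<exists>!G. (fix_step p q Ps)\<^sup>*\<^sup>* F G \<and> \<not> (\<exists>G'. fix_step p q Ps G G')"
  using fix_step_terminates[of p q Ps F] fix_step_stuck_subset[OF _ assms]
  by (metis subset_antisym)

lemma orbitope_matrices_keys:
  assumes "x \<in> orbitope_matrices p q"
  shows "Poly_Mapping.keys x \<subseteq> index_set p q"
proof (rule subsetI, rule ccontr)
  fix e assume "e \<in> Poly_Mapping.keys x" and "e \<notin> index_set p q"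
  moreover obtain i j where "e = (i, j)" by fastforce
  moreover define w where "w = (\<lambda>j. \<Sum>i=1..p. 2 ^ (p - i) * entry x (i, j))"
  ultimately have ij: "i \<in> {1..p}" "j \<in> {1..q}" "i < j" and nz: "entry x (i, j) \<noteq> 0"
    and w_def: "w = (\<lambda>j. \<Sum>i=1..p. 2 ^ (p - i) * entry x (i, j))"
    using assms by (auto simp: orbitope_matrices_def index_set_def)
  have vals: "entry x (a, b) = 0 \<or> entry x (a, b) = 1" if "a \<in> {1..p}" "b \<in> {1..q}" for a b
    using assms that by (auto simp: orbitope_matrices_def)
  have xij: "entry x (i, j) = 1"
    using vals[OF ij(1,2)] nz by simp
  have uniq: "\<exists>!b. b \<in> {1..q} \<and> entry x (a, b) = 1" if "a \<in> {1..p}" for a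
    using assms that by (auto simp: orbitope_matrices_def)
  have anti: "w j \<le> w b" if "1 \<le> b" "b \<le> j" for b
    using that(2,1)
  proof (induction rule: inc_induct)
    case (step b)
    have "w (Suc b) \<le> w b"
      using assms step ij(2) by (auto simp: orbitope_matrices_def w_def)
    then show ?case using step by simp
  qed simp
  have wj: "2 ^ (p - i) \<le> w j"
  proof -
    have "2 ^ (p - i) * entry x (i, j) \<le> w j"
      unfolding w_def using ij(1) vals[OF _ ij(2)] by (intro member_le_sum) force+
    then show ?thesis using xij by simp
  qed
  have "\<exists>a\<in>{1..i}. entry x (a, b) = 1" if b: "b \<in> {1..j}" for b
  proof (rule ccontr)
    assume no: "\<not> ?thesis"
    have bq: "b \<in> {1..q}" using b ij by auto
    have "w b = (\<Sum>a\<in>{i<..p}. 2 ^ (p - a) * entry x (a, b))"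
      unfolding w_def using no vals[OF _ bq] by (intro sum.mono_neutral_right) force+
    also have "\<dots> \<le> (\<Sum>a\<in>{i<..p}. 2 ^ (p - a))"
    proof (rule sum_mono)
      fix a assume "a \<in> {i<..p}"
      then have "entry x (a, b) = 0 \<or> entry x (a, b) = 1" by (intro vals bq) auto
      then show "2 ^ (p - a) * entry x (a, b) \<le> 2 ^ (p - a)" by auto
    qed
    also have "\<dots> = (\<Sum>k<p - i. (2::real) ^ k)"
      by (rule sum.reindex_bij_witness[of _ "\<lambda>k. p - k" "\<lambda>a. p - a"]) auto
    also have "\<dots> < 2 ^ (p - i)"
      by (simp add: geometric_sum)
    finally show False using wj anti[of b] b by simp
  qed
  then obtain f where f: "\<And>b. b \<in> {1..j} \<Longrightarrow> f b \<in> {1..i} \<and> entry x (f b, b) = 1"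
    by metis
  have "inj_on f {1..j}"
  proof (rule inj_onI)
    fix b c assume "b \<in> {1..j}" "c \<in> {1..j}" "f b = f c"
    then show "b = c"
      using f[of b] f[of c] uniq[of "f b"] ij by auto
  qed
  moreover have "f ` {1..j} \<subseteq> {1..i}" using f by blast
  ultimately have "card {1..j} \<le> card {1..i}" by (rule card_inj_on_le) simp
  then show False using ij(3) by simp
qed

end

theory Submission
  imports Defs
begin

text \<open>
  A 0/1-point with exactly one 1-entry per row is a function \<open>c\<close> from rows to columns, and it is a
  vertex of the orbitope iff \<open>c\<close> is a restricted growth function: every column is opened only after
  its predecessor. The 0/1-points of the affine hull of the orbitope are all these \<open>c\<close>. A face that is
  stable under all shifted column inequalities and the affine hull therefore amounts to a set \<open>A i\<close> of
  allowed columns for each row. Prescribing one value \<open>c i = j\<close> with \<open>j \<in> A i\<close> and choosing the other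
  values greedily gives a restricted growth function in the face: if the greedy choice got stuck, the
  positions where no new column could be opened would form a shifted column whose inequality is
  violated by every choice with \<open>c i = j\<close>, contradicting stability. So the vertices of the orbitope in
  the face already span it.
\<close>

subsection \<open>Iterated fixing\<close>

lemma fix_iter_spec:
  assumes "F face_of cube p q"
  shows "(fix_step p q Ps)\<^sup>*\<^sup>* F (fix_iter p q Ps F)"
    and "\<not> (\<exists>G'. fix_step p q Ps (fix_iter p q Ps F) G')"
  using theI'[OF fix_iter_unique[OF assms, of Ps]] unfolding fix_iter_def by auto

lemma fix_iter_face:
  "F face_of cube p q \<Longrightarrow> fix_iter p q Ps F face_of cube p q"
  using fix_step_reachable_face fix_iter_spec(1) by blast

lemma fix_iter_subset:
  assumes "F face_of cube p q"
  shows "fix_iter p q Ps F \<subseteq> F"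
  using fix_iter_spec(1)[OF assms, of Ps]
  by (induction rule: rtranclp_induct) (auto simp: fix_step_def)

lemma fix_iter_fixed:
  assumes "F face_of cube p q" "P \<in> Ps"
  shows "Fix p q (fix_iter p q Ps F) P = fix_iter p q Ps F"
  using fix_iter_spec(2)[OF assms(1), of Ps] Fix_subset[OF fix_iter_face[OF assms(1)]] assms(2)
  by (auto simp: fix_step_def psubset_eq)

text \<open>The final face is stable under \<open>P\<close> and fixing is monotone in the face, so a
  single step from \<open>F\<close> bounds the result. In the examples one inequality therefore
  suffices to witness strict shrinking.\<close>

lemma fix_iter_subset_Fix:
  assumes "F face_of cube p q" "P \<in> Ps"
  shows "fix_iter p q Ps F \<subseteq> Fix p q F P"
  using fix_iter_fixed[OF assms] Fix_mono[OF fix_iter_subset[OF assms(1)]] by metis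

text \<open>Monotonicity keeps \<open>K\<close> inside every intermediate face, whichever steps are
  taken, so lower bounds never require tracing the iteration.\<close>

lemma fix_iter_greatest:
  assumes "F face_of cube p q" "K \<subseteq> F" and K: "\<And>P. P \<in> Ps \<Longrightarrow> K \<subseteq> Fix p q K P"
  shows "K \<subseteq> fix_iter p q Ps F"
  using fix_iter_spec(1)[OF assms(1), of Ps] assms(2)
proof (induction rule: rtranclp_induct)
  case (step G G')
  then obtain P where "P \<in> Ps" "G' = Fix p q G P" by (auto simp: fix_step_def)
  then show ?case using K Fix_mono step by blast
qed

lemma fix_iter_eq_self:
  assumes "F face_of cube p q" "\<And>P. P \<in> Ps \<Longrightarrow> F \<subseteq> Fix p q F P"
  shows "fix_iter p q Ps F = F"
  using fix_iter_subset[OF assms(1)] fix_iter_greatest[OF assms(1) order.refl assms(2)] by blast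


subsection \<open>Faces of the cube spanned by 0/1-points\<close>

lemma entry_sum: "entry (\<Sum>x\<in>X. f x) k = (\<Sum>x\<in>X. entry (f x) k)"
  by (induction X rule: infinite_finite_induct) (auto simp: lookup_add)

text \<open>The barycentre of \<open>X\<close> lies in every face containing \<open>X\<close>, and it can be pushed a little
  away from \<open>z\<close> without leaving the cube.\<close>

lemma in_smallest_face_cube:
  assumes X: "X \<subseteq> zero_one_points p q" "X \<noteq> {}" and z: "z \<in> zero_one_points p q"
    and attained: "\<And>e. e \<in> index_set p q \<Longrightarrow> \<exists>x\<in>X. entry x e = entry z e"
  shows "z \<in> smallest_face (cube p q) X"
proof -
  have "z \<in> H" if H: "H face_of cube p q" "X \<subseteq> H" for H
  proof -
    have fin: "finite X" using X(1) finite_zero_one finite_subset by blast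
    define n where "n = real (card X)"
    have n: "n \<ge> 1" using fin X(2) unfolding n_def by (simp add: Suc_le_eq card_gt_0_iff)
    define b where "b = (\<Sum>x\<in>X. (1 / n) *\<^sub>R x)"
    have bH: "b \<in> H" unfolding b_def
      using H fin n face_of_imp_convex[OF H(1)] by (intro convex_sum) (auto simp: n_def)
    have be: "entry b k = (\<Sum>x\<in>X. entry x k) / n" for k
      by (simp add: b_def entry_sum lookup_scaleR sum_divide_distrib)
    \<comment> \<open>The step length \<open>1 / n\<close> is small enough: in each coordinate some
      point of \<open>X\<close> agrees with \<open>z\<close>, so the average is at most
      \<open>1 - 1 / n\<close> where \<open>z\<close> is 0 and at least \<open>1 / n\<close> where
      \<open>z\<close> is 1.\<close>
    define w where "w = b + (1 / n) *\<^sub>R (b - z)"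
    have we: "entry w k = entry b k + (entry b k - entry z k) / n" for k
      by (simp add: w_def lookup_add lookup_scaleR lookup_minus)
    have bc: "b \<in> cube p q" and zc: "z \<in> cube p q"
      using bH face_of_imp_subset[OF H(1)] z zero_one_subset_cube by auto
    have "w \<in> cube p q"
      unfolding cube_def
    proof (intro CollectI conjI ballI)
      show "Poly_Mapping.keys w \<subseteq> index_set p q"
      proof
        fix k assume "k \<in> Poly_Mapping.keys w"
        then have "entry b k \<noteq> 0 \<or> entry z k \<noteq> 0" using we[of k] by (auto simp: in_keys_iff)
        then show "k \<in> index_set p q" using bc zc by (auto simp: cube_def in_keys_iff)
      qed
      fix e assume e: "e \<in> index_set p q"
      then obtain x where x: "x \<in> X" "entry x e = entry z e" using attained by blast
      have b01: "0 \<le> entry b e" "entry b e \<le> 1" using bc e by (auto simp: cube_def)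
      have X01: "entry y e \<in> {0, 1}" if "y \<in> X" for y
        using X(1) that e by (auto simp: zero_one_points_def)
      have "entry z e = 0 \<or> entry z e = 1" using X01[OF x(1)] x(2) by auto
      then have "0 \<le> entry w e \<and> entry w e \<le> 1"
      proof
        assume z0: "entry z e = 0"
        have "(\<Sum>y\<in>X. entry y e) = (\<Sum>y\<in>X - {x}. entry y e)"
          using fin x z0 by (simp add: sum.remove)
        also have "\<dots> \<le> (\<Sum>y\<in>X - {x}. 1)"
          using X01 by (intro sum_mono) force
        also have "\<dots> = n - 1" using fin x n by (simp add: n_def of_nat_diff)
        finally have "entry b e \<le> (n - 1) / n" unfolding be using n by (simp add: divide_right_mono)
        then have "entry b e * (1 + 1 / n) \<le> (n - 1) / n * (1 + 1 / n)"
          using n by (intro mult_right_mono) auto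
        also have "\<dots> \<le> 1" using n by (simp add: field_simps)
        finally show ?thesis using z0 b01 n unfolding we by (simp add: field_simps)
      next
        assume z1: "entry z e = 1"
        have "1 \<le> (\<Sum>y\<in>X. entry y e)"
          using member_le_sum[OF x(1), of "\<lambda>y. entry y e"] fin X01 x z1 by force
        then have b1: "1 / n \<le> entry b e" unfolding be using n by (simp add: divide_right_mono)
        have "0 \<le> entry b e / n" using b01 n by simp
        moreover have "(entry b e - 1) / n \<le> 0" using b01 n by (simp add: divide_nonpos_pos)
        ultimately show ?thesis using z1 b01 b1 unfolding we by (simp add: diff_divide_distrib)
      qed
      then show "0 \<le> entry w e" "entry w e \<le> 1" by auto
    qed
    show "z \<in> H"
    proof (cases "b = z")
      case False
      \<comment> \<open>Solving the definition of \<open>w\<close> for \<open>b\<close> puts weight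
        \<open>n / (n + 1)\<close> on \<open>w\<close>. As \<open>b\<close> then lies strictly
        between \<open>z\<close> and \<open>w\<close>, the face property pulls \<open>z\<close> into
        \<open>H\<close>.\<close>
      have "b = (1 - n / (n + 1)) *\<^sub>R z + (n / (n + 1)) *\<^sub>R w"
      proof (rule poly_mapping_eqI)
        fix k
        have "1 - n / (n + 1) = 1 / (n + 1)" using n by (simp add: field_simps)
        moreover have "entry b k = (1 / (n + 1)) * entry z k + (n / (n + 1)) * entry w k"
          unfolding we using n by (simp add: divide_simps) (simp add: algebra_simps)
        ultimately show "entry b k = entry ((1 - n / (n + 1)) *\<^sub>R z + (n / (n + 1)) *\<^sub>R w) k"
          by (simp add: lookup_add lookup_scaleR)
      qed
      moreover have "z \<noteq> w"
      proof
        assume "z = w"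
        have "entry b k = entry z k" for k
        proof -
          have "(entry b k - entry z k) * (1 + 1 / n) = 0"
            using we[of k] \<open>z = w\<close> by (simp add: algebra_simps diff_divide_distrib)
          moreover have "1 + 1 / n \<noteq> 0" using n by (simp add: add_nonneg_eq_0_iff)
          ultimately show ?thesis by simp
        qed
        then show False using False poly_mapping_eqI by blast
      qed
      ultimately have "b \<in> open_segment z w"
        using n unfolding in_segment(2) by (intro conjI exI[of _ "n / (n + 1)"]) auto
      then show ?thesis using face_ofD[OF H(1)] \<open>w \<in> cube p q\<close> zc bH by blast
    qed (use bH in simp)
  qed
  then show ?thesis by (auto simp: smallest_face_def)
qed

text \<open>The values 0 and 1 are extreme on the cube: the slacks of the two endpoints enter with
  positive weights and sum to zero, so each vanishes.\<close>

lemma cube_coord_face: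
  assumes "v = 0 \<or> v = 1" "e \<in> index_set p q"
  shows "{x \<in> cube p q. entry x e = v} face_of cube p q"
  unfolding face_of_def
proof (intro conjI ballI impI)
  show "convex {x \<in> cube p q. entry x e = v}"
    using convex_cube[of p q] unfolding convex_def
    by (auto simp: lookup_add lookup_scaleR simp flip: distrib_right)
  fix a b x assume ab: "a \<in> cube p q" "b \<in> cube p q" and x: "x \<in> {x \<in> cube p q. entry x e = v}"
    and seg: "x \<in> open_segment a b"
  then obtain u where u: "0 < u" "u < 1" "x = (1 - u) *\<^sub>R a + u *\<^sub>R b"
    by (auto simp: in_segment)
  then have eq: "(1 - u) * entry a e + u * entry b e = v"
    using x by (auto simp: lookup_add lookup_scaleR)
  have bounds: "0 \<le> entry a e" "entry a e \<le> 1" "0 \<le> entry b e" "entry b e \<le> 1"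
    using ab assms by (auto simp: cube_def)
  have "entry a e = v \<and> entry b e = v"
    using assms(1)
  proof
    assume "v = 0"
    moreover have "0 \<le> (1 - u) * entry a e" "0 \<le> u * entry b e" using u bounds by auto
    ultimately have "(1 - u) * entry a e = 0" "u * entry b e = 0" using eq by linarith+
    then show ?thesis using u \<open>v = 0\<close> by auto
  next
    assume "v = 1"
    moreover have "0 \<le> (1 - u) * (1 - entry a e)" "0 \<le> u * (1 - entry b e)" using u bounds by auto
    moreover have "(1 - u) * (1 - entry a e) + u * (1 - entry b e) = 1 - v"
      using eq by (simp add: algebra_simps)
    ultimately have "(1 - u) * (1 - entry a e) = 0" "u * (1 - entry b e) = 0" by linarith+
    then show ?thesis using u \<open>v = 1\<close> by auto
  qed
  then show "a \<in> {x \<in> cube p q. entry x e = v}" "b \<in> {x \<in> cube p q. entry x e = v}"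
    using ab by auto
qed auto

text \<open>Together with \<open>in_smallest_face_cube\<close> this shows that a nonempty
  \<open>X\<close> spans a face whose free coordinates are exactly those on which \<open>X\<close>
  is not constant.\<close>

lemma smallest_face_coord:
  assumes "X \<subseteq> zero_one_points p q" "e \<in> index_set p q" "v = 0 \<or> v = 1"
    and "\<And>x. x \<in> X \<Longrightarrow> entry x e = v" and "y \<in> smallest_face (cube p q) X"
  shows "entry y e = v"
  using smallest_face_least[OF cube_coord_face[OF assms(3,2)], of X] assms zero_one_subset_cube
  by blast


subsection \<open>Points with one 1-entry per row\<close>

definition ind_point :: "(nat \<times> nat) set \<Rightarrow> point"
  where "ind_point E = Abs_poly_mapping (indicator E)"

definition choice_point :: "nat \<Rightarrow> (nat \<Rightarrow> nat) \<Rightarrow> point"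
  where "choice_point p c = ind_point ((\<lambda>i. (i, c i)) ` {1..p})"

definition row_choice :: "nat \<Rightarrow> nat \<Rightarrow> (nat \<Rightarrow> nat) \<Rightarrow> bool"
  where "row_choice p q c \<longleftrightarrow> (\<forall>i\<in>{1..p}. c i \<in> {1..min i q})"

text \<open>For positive \<open>c\<close> these functions encode set partitions with blocks numbered
  by their first elements. Only the direct predecessor is demanded; all smaller columns follow by
  descent.\<close>

definition restricted_growth :: "nat \<Rightarrow> (nat \<Rightarrow> nat) \<Rightarrow> bool"
  where "restricted_growth p c \<longleftrightarrow> (\<forall>i\<in>{1..p}. 1 < c i \<longrightarrow> (\<exists>k\<in>{1..<i}. c k = c i - 1))"

lemma lookup_ind_point: "finite E \<Longrightarrow> entry (ind_point E) e = indicator E e"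
  unfolding ind_point_def
  by (subst lookup_Abs_poly_mapping) (auto simp: indicator_def elim: finite_subset[rotated])

lemma lookup_choice_point:
  "entry (choice_point p c) (i, j) = (if i \<in> {1..p} \<and> c i = j then 1 else 0)"
  by (auto simp: choice_point_def lookup_ind_point indicator_def)

lemma ind_point_zero_one:
  assumes "E \<subseteq> index_set p q"
  shows "ind_point E \<in> zero_one_points p q"
proof -
  have "finite E" using assms finite_index_set finite_subset by blast
  then show ?thesis using assms
    by (auto simp: zero_one_points_def in_keys_iff lookup_ind_point indicator_def)
qed

lemma choice_point_zero_one:
  "row_choice p q c \<Longrightarrow> choice_point p c \<in> zero_one_points p q"
  unfolding choice_point_def row_choice_def
  by (rule ind_point_zero_one) (auto simp: index_set_def)

lemma finite_row [simp]: "finite (row q i)" by (simp add: row_def)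

lemma row_subset: "i \<in> {1..p} \<Longrightarrow> row q i \<subseteq> index_set p q"
  by (auto simp: row_def index_set_def)

lemma sum_bar_choice_point:
  assumes "row_choice p q c" "i \<in> {1..p}"
  shows "(\<Sum>e\<in>bar q i j. entry (choice_point p c) e) = (if j \<le> c i then 1 else 0)"
proof -
  have "(\<Sum>e\<in>bar q i j. entry (choice_point p c) e)
      = (\<Sum>k\<in>{j..min i q}. entry (choice_point p c) (i, k))"
    unfolding bar_def by (rule sum.reindex_bij_witness[of _ "\<lambda>k. (i, k)" snd]) auto
  also have "\<dots> = (\<Sum>k\<in>{j..min i q}. if k = c i then 1 else 0)"
    using assms(2) by (intro sum.cong) (auto simp: lookup_choice_point)
  finally show ?thesis using assms by (auto simp: row_choice_def)
qed

lemma row_eq_bar: "row q i = bar q i 1"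
  by (simp add: row_def bar_def)

lemma sum_row_choice_point:
  assumes "row_choice p q c" "i \<in> {1..p}"
  shows "(\<Sum>e\<in>row q i. entry (choice_point p c) e) = 1"
  using assms by (auto simp: row_eq_bar sum_bar_choice_point row_choice_def)

text \<open>In each row, 0/1-entries with sum 1 contain exactly one 1. This serves both the vertices
  of the orbitope and the 0/1-points of its affine hull.\<close>

lemma zero_one_row_sum_choice:
  assumes x: "x \<in> zero_one_points p q"
    and sum1: "\<And>i. i \<in> {1..p} \<Longrightarrow> (\<Sum>e\<in>row q i. entry x e) = 1"
  obtains c where "row_choice p q c" "x = choice_point p c"
proof -
  have x01: "entry x e \<in> {0, 1}" if "e \<in> index_set p q" for e
    using x that by (auto simp: zero_one_points_def)
  have ex1: "\<exists>j. j \<in> {1..min i q} \<and> (\<forall>k\<in>{1..min i q}. entry x (i, k) = (if k = j then 1 else 0))"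
    if i: "i \<in> {1..p}" for i
  proof -
    have "\<exists>e\<in>row q i. entry x e \<noteq> 0" using sum1[OF i] by (metis sum.neutral zero_neq_one)
    then obtain j where j: "(i, j) \<in> row q i" "entry x (i, j) \<noteq> 0"
      by (auto simp: row_def)
    then have j1: "entry x (i, j) = 1" using x01[of "(i, j)"] row_subset[OF i] by blast
    have nn: "0 \<le> entry x e" if "e \<in> row q i" for e
      using x01[of e] row_subset[OF i] that by force
    have "(\<Sum>e\<in>row q i - {(i, j)}. entry x e) = 0"
      using sum1[OF i] j j1 by (simp add: sum.remove)
    then have "\<forall>e\<in>row q i - {(i, j)}. entry x e = 0"
      using nn by (subst (asm) sum_nonneg_eq_0_iff) auto
    then show ?thesis using j j1 by (intro exI[of _ j]) (auto simp: row_def)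
  qed
  then obtain c where c: "\<And>i. i \<in> {1..p} \<Longrightarrow> c i \<in> {1..min i q}"
    and cx: "\<And>i k. i \<in> {1..p} \<Longrightarrow> k \<in> {1..min i q} \<Longrightarrow> entry x (i, k) = (if k = c i then 1 else 0)"
    by metis
  have "x = choice_point p c"
  proof (rule poly_mapping_eqI)
    fix e :: "nat \<times> nat" obtain i k where e: "e = (i, k)" by fastforce
    show "entry x e = entry (choice_point p c) e"
    proof (cases "e \<in> index_set p q")
      case True
      then show ?thesis using cx[of i k] e by (auto simp: index_set_def lookup_choice_point)
    next
      case False
      then have "entry x e = 0" using x by (auto simp: zero_one_points_def in_keys_iff)
      moreover have "\<not> (i \<in> {1..p} \<and> c i = k)"
        using False c[of i] by (auto simp: e index_set_def)
      ultimately show ?thesis by (simp add: e lookup_choice_point)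
    qed
  qed
  moreover have "row_choice p q c" using c by (simp add: row_choice_def)
  ultimately show thesis using that by blast
qed

subsection \<open>Points satisfying the systems\<close>

lemma sum_indicator_index_set:
  assumes "B \<subseteq> index_set p q"
  shows "(\<Sum>e\<in>index_set p q. indicator B e * f e) = (\<Sum>e\<in>B. f e :: real)"
  by (rule sum.mono_neutral_cong_right[OF finite_index_set assms]) (auto simp: indicator_def)

lemma solutions_in_cube_pair_iff:
  assumes "B \<subseteq> index_set p q" "S \<subseteq> index_set p q"
  shows "x \<in> solutions_in_cube p q (\<lambda>e. indicator B e - indicator S e, 0) \<longleftrightarrow>
    x \<in> cube p q \<and> (\<Sum>e\<in>B. entry x e) \<le> (\<Sum>e\<in>S. entry x e)"
  by (simp add: solutions_in_cube_def left_diff_distrib sum_subtractf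
      sum_indicator_index_set[OF assms(1)] sum_indicator_index_set[OF assms(2)])

lemma solutions_nonneg:
  "x \<in> cube p q \<Longrightarrow> r \<in> nonneg_ineqs p q \<Longrightarrow> x \<in> solutions_in_cube p q r"
  by (auto simp: nonneg_ineqs_def solutions_in_cube_def cube_def sum_negf sum_indicator_index_set)

lemma solutions_row_sum:
  assumes "x \<in> cube p q" "r \<in> row_sum_ineqs p q"
    and "\<And>i. i \<in> {1..p} \<Longrightarrow> (\<Sum>e\<in>row q i. entry x e) = 1"
  shows "x \<in> solutions_in_cube p q r"
  using assms row_subset
  by (auto simp: row_sum_ineqs_def solutions_in_cube_def sum_negf sum_indicator_index_set)

lemma solutions_in_cube_le:
  assumes "x \<in> solutions_in_cube p q (\<lambda>e. indicator B e - indicator S e, 0)"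
    "B \<subseteq> index_set p q" "S \<subseteq> index_set p q"
  shows "(\<Sum>e\<in>B. entry x e) \<le> (\<Sum>e\<in>S. entry x e)"
  using assms by (simp add: solutions_in_cube_pair_iff)

lemma bar_subset: "(i, j) \<in> index_set p q \<Longrightarrow> bar q i j \<subseteq> index_set p q"
  by (auto simp: bar_def index_set_def)

text \<open>The bar sum is 0 or 1, and the sum over \<open>S\<close> is at least 1 iff
  \<open>S\<close> is hit, so the inequality becomes a combinatorial condition on
  \<open>c\<close>.\<close>

lemma choice_point_satisfies_SCI_iff:
  assumes c: "row_choice p q c" and ij: "(i, j) \<in> index_set p q" and S: "shifted_column p q \<eta> s S"
  shows "choice_point p c \<in> solutions_in_cube p q (\<lambda>e. indicator (bar q i j) e - indicator S e, 0)
    \<longleftrightarrow> (j \<le> c i \<longrightarrow> (\<exists>k\<in>{1..\<eta>}. c (s k + k - 1) = s k))"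
proof -
  have S': "S = (\<lambda>k. (s k + k - 1, s k)) ` {1..\<eta>}" "S \<subseteq> index_set p q"
    using S by (auto simp: shifted_column_def diag_coord_def)
  have fin: "finite S" using S'(1) by simp
  have i: "i \<in> {1..p}" using ij by (simp add: index_set_def)
  have x01: "entry (choice_point p c) e = 0 \<or> entry (choice_point p c) e = 1" for e
    by (cases e) (simp add: lookup_choice_point)
  have nn: "0 \<le> (\<Sum>e\<in>S. entry (choice_point p c) e)" 
    by (rule sum_nonneg) (metis x01 order.refl zero_le_one)
  have "1 \<le> (\<Sum>e\<in>S. entry (choice_point p c) e) \<longleftrightarrow> (\<exists>e\<in>S. entry (choice_point p c) e = 1)"
  proof
    assume "1 \<le> (\<Sum>e\<in>S. entry (choice_point p c) e)"
    then have "\<exists>e\<in>S. entry (choice_point p c) e \<noteq> 0"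
      by (metis not_one_le_zero sum.neutral)
    then show "\<exists>e\<in>S. entry (choice_point p c) e = 1" using x01 by blast
  next
    assume "\<exists>e\<in>S. entry (choice_point p c) e = 1"
    then obtain e where "e \<in> S" "entry (choice_point p c) e = 1" by blast
    then show "1 \<le> (\<Sum>e\<in>S. entry (choice_point p c) e)"
      using member_le_sum[of e S "entry (choice_point p c)"] fin x01
      by (metis Diff_iff order.refl zero_le_one)
  qed
  also have "\<dots> \<longleftrightarrow> (\<exists>k\<in>{1..\<eta>}. c (s k + k - 1) = s k)"
    using S'(2) unfolding S'(1) by (fastforce simp: lookup_choice_point index_set_def)
  finally have *: "1 \<le> (\<Sum>e\<in>S. entry (choice_point p c) e)
    \<longleftrightarrow> (\<exists>k\<in>{1..\<eta>}. c (s k + k - 1) = s k)" .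
  have "choice_point p c \<in> cube p q"
    using choice_point_zero_one[OF c] zero_one_subset_cube by blast
  then show ?thesis
    using nn * by (simp add: solutions_in_cube_pair_iff[OF bar_subset[OF ij] S'(2)]
        sum_bar_choice_point[OF c i])
qed

lemma choice_point_solves_basic:
  assumes "row_choice p q c" "r \<in> nonneg_ineqs p q \<union> row_sum_ineqs p q"
  shows "choice_point p c \<in> solutions_in_cube p q r"
proof -
  have "choice_point p c \<in> cube p q"
    using choice_point_zero_one[OF assms(1)] zero_one_subset_cube by blast
  then show ?thesis
    using assms solutions_nonneg solutions_row_sum[OF _ _ sum_row_choice_point[OF assms(1)]] by blast
qed

subsection \<open>Vertices of the orbitope as restricted growth functions\<close>

lemma restricted_growthD:
  "restricted_growth p c \<Longrightarrow> i \<in> {1..p} \<Longrightarrow> 1 < c i \<Longrightarrow> \<exists>k\<in>{1..<i}. c k = c i - 1"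
  unfolding restricted_growth_def by blast

lemma shifted_column_pos:
  assumes "shifted_column p q \<eta> s S" "k \<in> {1..\<eta>}"
  shows "1 \<le> s k"
proof -
  have "diag_coord k (s k) \<in> index_set p q"
    using assms unfolding shifted_column_def by blast
  then show ?thesis by (simp add: diag_coord_def index_set_def)
qed

text \<open>Going from a row to an earlier one in the preceding column moves one column left and at
  least one row up, so the diagonal index never grows. The chain from row \<open>i\<close> back to
  column 1 starts to the right of the monotone \<open>s\<close> and cannot pass to its left without
  meeting it.\<close>

lemma restricted_growth_hits_shifted_column:
  assumes c: "row_choice p q c" "restricted_growth p c"
    and i: "i \<in> {1..p}" "i = j + \<eta> - 1" "1 \<le> \<eta>" "j \<le> c i"
    and s: "mono_on {1..\<eta>} s" "\<And>k. k \<in> {1..\<eta>} \<Longrightarrow> 1 \<le> s k" "s \<eta> < j"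
  shows "\<exists>k\<in>{1..\<eta>}. c (s k + k - 1) = s k"
proof (rule ccontr)
  assume no: "\<not> ?thesis"
  have cb: "1 \<le> c r" "c r \<le> r" if "r \<in> {1..p}" for r
    using c(1) that by (auto simp: row_choice_def)
  text \<open>Without a hit, the growth function stays to the left of the shifted column on each of the
    first \<open>\<eta>\<close> diagonals.\<close>
  have left: "c r < s (r - c r + 1)" if "r \<in> {1..p}" "r - c r + 1 \<le> \<eta>" for r
    using that
  proof (induction r rule: less_induct)
    case (less r)
    let ?k = "r - c r + 1"
    have k: "?k \<in> {1..\<eta>}" using less.prems by auto
    have "c r \<le> s ?k"
    proof (cases "c r = 1")
      case False
      then obtain r' where r': "r' \<in> {1..<r}" "c r' = c r - 1"
        using restricted_growthD[OF c(2) less.prems(1)] cb[OF less.prems(1)] by auto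
      have r'p: "r' \<in> {1..p}" using r' less.prems by auto
      have le: "r' - c r' + 1 \<le> ?k" using r' cb[OF less.prems(1)] cb[OF r'p] by auto
      have "c r' < s (r' - c r' + 1)"
        using less.IH[of r'] r' r'p le less.prems by auto
      also have "\<dots> \<le> s ?k" using s(1) k le by (intro mono_onD[OF s(1)]) auto
      finally show ?thesis using r' by linarith
    qed (use s(2)[OF k] in simp)
    moreover have "c r \<noteq> s ?k"
    proof
      assume "c r = s ?k"
      then have "s ?k + ?k - 1 = r" using cb[OF less.prems(1)] by simp
      then have "c (s ?k + ?k - 1) = c r" by (rule arg_cong)
      then show False using no k \<open>c r = s ?k\<close> by metis
    qed
    ultimately show ?case by simp
  qed
  \<comment> \<open>Moving right within row \<open>i\<close> lowers the diagonal index, so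
    \<open>j <= c i\<close> keeps it at most \<open>\<eta>\<close>.\<close>
  have "i - c i + 1 \<le> \<eta>" using i by auto
  then have "c i < s (i - c i + 1)" using left i(1) by blast
  also have "\<dots> \<le> s \<eta>" using \<open>i - c i + 1 \<le> \<eta>\<close> i(3) by (intro mono_onD[OF s(1)]) auto
  finally show False using s(3) i(4) by linarith
qed

lemma restricted_growth_solves_SCI_system:
  assumes c: "row_choice p q c" "restricted_growth p c" and r: "r \<in> SCI_system p q"
  shows "choice_point p c \<in> solutions_in_cube p q r"
  using r choice_point_solves_basic[OF c(1)] unfolding SCI_system_def
proof (elim UnE)
  assume "r \<in> shifted_column_ineqs p q"
  then obtain i j \<eta> s S where r: "r = (\<lambda>e. indicator (bar q i j) e - indicator S e, 0)"
    and ij: "(i, j) \<in> index_set p q" "(i, j) = diag_coord \<eta> j"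
    and S: "shifted_column p q \<eta> s S" "s \<eta> < j"
    unfolding shifted_column_ineqs_def by blast
  then show ?thesis
    unfolding r choice_point_satisfies_SCI_iff[OF c(1) ij(1) S(1)]
    using restricted_growth_hits_shifted_column[OF c, of i j \<eta> s] ij S shifted_column_pos[OF S(1)]
    by (auto simp: shifted_column_def diag_coord_def index_set_def)
qed auto

section \<open>Lexicographic order of columns through binary weights\<close>

lemma column_weight_choice_point:
  "(\<Sum>i=1..p. 2 ^ (p - i) * entry (choice_point p c) (i, j)) = (\<Sum>i\<in>{i\<in>{1..p}. c i = j}. 2 ^ (p - i))"
  by (rule sum.mono_neutral_cong_right) (auto simp: lookup_choice_point)

lemma binary_tail_less:
  assumes "k \<le> p" shows "(\<Sum>i\<in>{k<..p}. 2 ^ (p - i)) < (2 ^ (p - k) :: real)"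
proof -
  have "(\<Sum>i\<in>{k<..p}. 2 ^ (p - i)) = (\<Sum>l<p - k. (2::real) ^ l)"
    by (rule sum.reindex_bij_witness[of _ "\<lambda>l. p - l" "\<lambda>i. p - i"]) auto
  then show ?thesis by (simp add: geometric_sum)
qed

text \<open>A power of two exceeds the sum of all smaller ones, so the topmost 1-entries decide the
  comparison of two columns.\<close>

lemma column_weight_less:
  assumes "k \<le> p" "\<And>i. i \<in> {1..p} \<Longrightarrow> c i = j \<Longrightarrow> k < i"
  shows "(\<Sum>i\<in>{i\<in>{1..p}. c i = j}. 2 ^ (p - i)) < (2 ^ (p - k) :: real)"
proof -
  have "(\<Sum>i\<in>{i\<in>{1..p}. c i = j}. 2 ^ (p - i)) \<le> (\<Sum>i\<in>{k<..p}. (2::real) ^ (p - i))"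
    using assms by (intro sum_mono2) auto
  also note binary_tail_less[OF assms(1)]
  finally show ?thesis .
qed

lemma column_weight_ge:
  assumes "k \<in> {1..p}" "c k = j"
  shows "(2 ^ (p - k) :: real) \<le> (\<Sum>i\<in>{i\<in>{1..p}. c i = j}. 2 ^ (p - i))"
  using assms by (intro member_le_sum) auto

lemma restricted_growth_orbitope_matrices:
  assumes c: "row_choice p q c" "restricted_growth p c"
  shows "choice_point p c \<in> orbitope_matrices p q"
proof -
  have keys: "Poly_Mapping.keys (choice_point p c) \<subseteq> {1..p} \<times> {1..q}"
    using c(1) by (auto simp: in_keys_iff lookup_choice_point row_choice_def split: if_splits)
  have uniq: "\<exists>!j. j \<in> {1..q} \<and> entry (choice_point p c) (i, j) = 1" if "i \<in> {1..p}" for i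
    using c(1) that by (intro ex1I[of _ "c i"]) (auto simp: lookup_choice_point row_choice_def split: if_splits)
  have lex: "(\<Sum>i\<in>{i\<in>{1..p}. c i = j + 1}. 2 ^ (p - i)) \<le> (\<Sum>i\<in>{i\<in>{1..p}. c i = j}. 2 ^ (p - i) :: real)"
    if j: "j \<in> {1..<q}" for j
  proof (cases "\<exists>i. i \<in> {1..p} \<and> c i = j + 1")
    case True
    define i where "i = (LEAST i. i \<in> {1..p} \<and> c i = j + 1)"
    have i: "i \<in> {1..p}" "c i = j + 1" using LeastI_ex[OF True] by (auto simp: i_def)
    obtain k where k: "k \<in> {1..<i}" "c k = j"
      using restricted_growthD[OF c(2) i(1)] i j by auto
    have "k < i'" if "i' \<in> {1..p}" "c i' = j + 1" for i'
      using k(1) Least_le[of "\<lambda>i. i \<in> {1..p} \<and> c i = j + 1" i'] that by (auto simp: i_def)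
    then show ?thesis
      using column_weight_less[of k p c "j + 1"] column_weight_ge[of k p c j] k i by auto
  next
    case False
    then have "{i \<in> {1..p}. c i = j + 1} = {}" by auto
    then show ?thesis by (simp only: sum.empty) (simp add: sum_nonneg)
  qed
  show ?thesis
    unfolding orbitope_matrices_def mem_Collect_eq column_weight_choice_point
    using keys uniq lex by (intro conjI ballI) (simp_all add: lookup_choice_point)
qed

text \<open>If row \<open>i\<close> used column \<open>c i > 1\<close> with no earlier row in column
  \<open>c i - 1\<close>, the right column would weigh at least \<open>2 ^ (p - i)\<close> and the
  left one less, against the lexicographic order.\<close>

lemma orbitope_matrices_restricted_growth:
  assumes x: "x \<in> orbitope_matrices p q"
  obtains c where "row_choice p q c" "restricted_growth p c" "x = choice_point p c"
proof -
  have keys: "Poly_Mapping.keys x \<subseteq> index_set p q" by (rule orbitope_matrices_keys[OF x])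
  have x01: "entry x (i, j) = 0 \<or> entry x (i, j) = 1" if "i \<in> {1..p}" "j \<in> {1..q}" for i j
    using x that by (auto simp: orbitope_matrices_def)
  have "x \<in> zero_one_points p q"
    using keys x01 by (auto simp: zero_one_points_def index_set_def)
  moreover have "(\<Sum>e\<in>row q i. entry x e) = 1" if i: "i \<in> {1..p}" for i
  proof -
    have uniq: "\<exists>!j. j \<in> {1..q} \<and> entry x (i, j) = 1" using x i by (auto simp: orbitope_matrices_def)
    then obtain j where j: "j \<in> {1..q}" "entry x (i, j) = 1" by blast
    then have jr: "(i, j) \<in> row q i" 
      using subsetD[OF keys, of "(i, j)"] by (auto simp: row_def index_set_def in_keys_iff)
    have "(\<Sum>e\<in>row q i. entry x e) = (\<Sum>e\<in>row q i. if e = (i, j) then 1 else 0)"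
    proof (rule sum.cong)
      fix e assume "e \<in> row q i"
      then obtain k where "e = (i, k)" "k \<in> {1..q}" by (auto simp: row_def)
      then show "entry x e = (if e = (i, j) then 1 else 0)"
        using uniq j x01[OF i, of k] by auto
    qed simp
    then show ?thesis using jr by simp
  qed
  ultimately obtain c where c: "row_choice p q c" "x = choice_point p c"
    by (rule zero_one_row_sum_choice)
  have "restricted_growth p c"
    unfolding restricted_growth_def
  proof (intro ballI impI, rule ccontr)
    fix i assume i: "i \<in> {1..p}" "1 < c i" and no: "\<not> (\<exists>k\<in>{1..<i}. c k = c i - 1)"
    let ?j = "c i - 1"
    have "c i \<le> q" using i c(1) by (auto simp: row_choice_def)
    then have "?j \<in> {1..<q}" using i by auto
    then have "(\<Sum>a\<in>{a\<in>{1..p}. c a = ?j + 1}. 2 ^ (p - a)) \<le> (\<Sum>a\<in>{a\<in>{1..p}. c a = ?j}. 2 ^ (p - a) :: real)"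
      using x unfolding c(2) orbitope_matrices_def mem_Collect_eq column_weight_choice_point by blast
    moreover have "(2 ^ (p - i) :: real) \<le> (\<Sum>a\<in>{a\<in>{1..p}. c a = ?j + 1}. 2 ^ (p - a))"
      using i by (intro column_weight_ge) auto
    moreover have "(\<Sum>a\<in>{a\<in>{1..p}. c a = ?j}. 2 ^ (p - a)) < (2 ^ (p - i) :: real)"
    proof (rule column_weight_less)
      fix a assume a: "a \<in> {1..p}" "c a = ?j"
      then have "a \<noteq> i" using i by auto
      then show "i < a" using a no by (meson atLeastAtMost_iff atLeastLessThan_iff linorder_neqE_nat)
    qed (use i in simp)
    ultimately show False by linarith
  qed
  then show thesis using that c by blast
qed

section \<open>Valid inequalities and the affine hull of the orbitope\<close>

lemma orbitope_subset_solutions: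
  assumes "r \<in> SCI_system p q"
  shows "orbitope p q \<subseteq> solutions_in_cube p q r"
  unfolding orbitope_def
proof (rule hull_minimal)
  show "orbitope_matrices p q \<subseteq> solutions_in_cube p q r"
    using assms restricted_growth_solves_SCI_system by (metis orbitope_matrices_restricted_growth subsetI)
  obtain a b where r: "r = (a, b)" by fastforce
  have "convex {x. (\<Sum>e\<in>index_set p q. a e * entry x e) \<le> b}"
  proof (rule convexI)
    fix x y :: point and u v :: real
    assume xy: "x \<in> {x. (\<Sum>e\<in>index_set p q. a e * entry x e) \<le> b}"
      "y \<in> {x. (\<Sum>e\<in>index_set p q. a e * entry x e) \<le> b}" and uv: "0 \<le> u" "0 \<le> v" "u + v = 1"
    have "(\<Sum>e\<in>index_set p q. a e * entry (u *\<^sub>R x + v *\<^sub>R y) e)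
        = u * (\<Sum>e\<in>index_set p q. a e * entry x e) + v * (\<Sum>e\<in>index_set p q. a e * entry y e)"
      by (simp add: lookup_add lookup_scaleR sum_distrib_left sum.distrib algebra_simps)
    also have "\<dots> \<le> b" using xy uv by (intro convex_bound_le) auto
    finally show "u *\<^sub>R x + v *\<^sub>R y \<in> {x. (\<Sum>e\<in>index_set p q. a e * entry x e) \<le> b}" by simp
  qed
  then have "convex (cube p q \<inter> {x. (\<Sum>e\<in>index_set p q. a e * entry x e) \<le> b})"
    by (intro convex_Int convex_cube)
  moreover have "solutions_in_cube p q r = cube p q \<inter> {x. (\<Sum>e\<in>index_set p q. a e * entry x e) \<le> b}"
    by (auto simp: r solutions_in_cube_def)
  ultimately show "convex (solutions_in_cube p q r)" by simp
qed

lemma affine_hull_orbitope_row_sum: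
  assumes "x \<in> affine hull orbitope p q" "i \<in> {1..p}"
  shows "(\<Sum>e\<in>row q i. entry x e) = 1"
proof -
  let ?R = "{x. (\<Sum>e\<in>row q i. entry x e) = 1}"
  have aff: "affine ?R"
    unfolding affine_def
    by (auto simp: lookup_add lookup_scaleR sum.distrib simp flip: sum_distrib_left)
  have "orbitope_matrices p q \<subseteq> ?R"
    using assms(2) sum_row_choice_point by (auto elim!: orbitope_matrices_restricted_growth)
  then have "orbitope p q \<subseteq> ?R"
    unfolding orbitope_def by (rule hull_minimal) (rule affine_imp_convex[OF aff])
  then have "affine hull orbitope p q \<subseteq> ?R" using aff by (rule hull_minimal)
  then show ?thesis using assms(1) by blast
qed

text \<open>The growth functions \<open>1, 2, \<dots>, j - 1, 1, \<dots>, 1\<close> with the entry \<open>1\<close> or \<open>j\<close> in row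
  \<open>i \<ge> j\<close> show that the 1-entry of row \<open>i\<close> can be moved freely within the affine hull.\<close>

lemma choice_point_affine_hull:
  assumes c: "row_choice p q c"
  shows "choice_point p c \<in> affine hull orbitope p q"
proof -
  have mem: "choice_point p d \<in> affine hull orbitope p q"
    if "row_choice p q d" "restricted_growth p d" for d
    using restricted_growth_orbitope_matrices[OF that] unfolding orbitope_def by (simp add: hull_inc)
  \<comment> \<open>Rows are switched to \<open>c\<close> one at a time, starting from the constant
    function 1, which is a restricted growth function.\<close>
  have "choice_point p (\<lambda>i. if i \<le> n then c i else 1) \<in> affine hull orbitope p q" if "n \<le> p" for n
    using that
  proof (induction n)
    case 0
    show ?case
      using c by (intro mem) (auto simp: row_choice_def restricted_growth_def)
  next
    case (Suc n)
    define j where "j = c (Suc n)"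
    have j: "1 \<le> j" "j \<le> Suc n" "j \<le> q"
      using c Suc.prems by (auto simp: row_choice_def j_def)
    define v where "v = (\<lambda>i. if i < j then i else 1)"
    define u where "u = v(Suc n := j)"
    have "choice_point p v \<in> affine hull orbitope p q"
      using j by (intro mem) (auto simp: row_choice_def restricted_growth_def v_def intro: bexI[of _ "_ - 1"])
    moreover have "choice_point p u \<in> affine hull orbitope p q"
    proof (rule mem)
      show "row_choice p q u" using j by (auto simp: row_choice_def u_def v_def)
      show "restricted_growth p u"
        unfolding restricted_growth_def
      proof (intro ballI impI)
        fix i assume "i \<in> {1..p}" "1 < u i"
        then show "\<exists>k\<in>{1..<i}. u k = u i - 1"
          using j by (intro bexI[of _ "u i - 1"]) (auto simp: u_def v_def split: if_splits)
      qed
    qed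
    moreover have "choice_point p (\<lambda>i. if i \<le> n then c i else 1) \<in> affine hull orbitope p q"
      using Suc by simp
    \<comment> \<open>\<open>u\<close> and \<open>v\<close> agree outside row \<open>Suc n\<close>,
      where \<open>v\<close> has column 1 because \<open>j <= Suc n\<close>. Adding the difference
      moves the 1-entry of that row from column 1 to \<open>j\<close>.\<close>
    ultimately have "choice_point p (\<lambda>i. if i \<le> n then c i else 1)
        + 1 *\<^sub>R (choice_point p u - choice_point p v) \<in> affine hull orbitope p q"
      by (intro mem_affine_3_minus) auto
    moreover have "choice_point p (\<lambda>i. if i \<le> Suc n then c i else 1)
      = choice_point p (\<lambda>i. if i \<le> n then c i else 1) + 1 *\<^sub>R (choice_point p u - choice_point p v)"
    proof (rule poly_mapping_eqI)
      fix e :: "nat \<times> nat" obtain i k where e: "e = (i, k)" by fastforce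
      have "i \<le> n \<or> i = Suc n \<or> Suc n < i" by linarith
      then show "entry (choice_point p (\<lambda>i. if i \<le> Suc n then c i else 1)) e
        = entry (choice_point p (\<lambda>i. if i \<le> n then c i else 1)
            + 1 *\<^sub>R (choice_point p u - choice_point p v)) e"
        using j by (auto simp: e lookup_add lookup_minus lookup_choice_point u_def v_def j_def)
    qed
    ultimately show ?case by simp
  qed
  from this[of p] have "choice_point p (\<lambda>i. if i \<le> p then c i else 1) \<in> affine hull orbitope p q" by simp
  moreover have "choice_point p (\<lambda>i. if i \<le> p then c i else 1) = choice_point p c"
    unfolding choice_point_def by (intro arg_cong[of _ _ ind_point] image_cong) auto
  ultimately show ?thesis by simp
qed

subsection \<open>Fixing with respect to the affine hull is complete\<close>

text \<open>Greedy construction: \<open>c\<close> opens the new column \<open>m + 1\<close> whenever row \<open>n + 1\<close> allows it. Each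
  row in which it cannot do so contributes the forbidden position \<open>(n + 1, m + 1)\<close>, and these
  positions form a shifted column \<open>s\<close>. If row \<open>n + 1\<close> admits no column up to \<open>m + 1\<close> at all, the
  shifted column inequality of \<open>s\<close> and \<open>(n + 1, m + 2)\<close> is violated by every choice from \<open>A\<close>.\<close>

lemma restricted_growth_choice_exists:
  assumes A: "\<And>i. i \<in> {1..p} \<Longrightarrow> A i \<subseteq> {1..min i q}" and ne: "\<And>i. i \<in> {1..p} \<Longrightarrow> A i \<noteq> {}"
    and sat: "\<And>i j \<eta> s S. (i, j) \<in> index_set p q \<Longrightarrow> (i, j) = diag_coord \<eta> j \<Longrightarrow>
      shifted_column p q \<eta> s S \<Longrightarrow> s \<eta> < j \<Longrightarrow>
      \<exists>c. (\<forall>i\<in>{1..p}. c i \<in> A i) \<and> (j \<le> c i \<longrightarrow> (\<exists>k\<in>{1..\<eta>}. c (s k + k - 1) = s k))"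
  shows "\<exists>c. (\<forall>i\<in>{1..p}. c i \<in> A i) \<and> restricted_growth p c"
proof -
  \<comment> \<open>\<open>m\<close> counts the opened columns. Each of the other
    \<open>n - m\<close> rows contributes one blocked position; the one with index \<open>k\<close>
    lies on diagonal \<open>k\<close>, in row \<open>s k + k - 1\<close>.\<close>
  have "\<exists>c m s. (\<forall>i\<in>{1..n}. c i \<in> A i) \<and> restricted_growth n c \<and> m \<le> n \<and> c ` {1..n} = {1..m} \<and>
      mono_on {1..n - m} s \<and> (\<forall>k\<in>{1..n - m}. 1 \<le> s k \<and> s k \<le> m + 1 \<and> s k + k - 1 \<le> n \<and>
      s k \<notin> A (s k + k - 1))" if "n \<le> p" for n
    using that
  proof (induction n)
    case 0
    show ?case by (intro exI[of _ "\<lambda>_. 0"] exI[of _ 0]) (simp add: restricted_growth_def)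
  next
    case (Suc n)
    then obtain c m s where c: "\<forall>i\<in>{1..n}. c i \<in> A i" "restricted_growth n c" "c ` {1..n} = {1..m}"
      and m: "m \<le> n" and mono: "mono_on {1..n - m} s"
      and s: "\<forall>k\<in>{1..n - m}. 1 \<le> s k \<and> s k \<le> m + 1 \<and> s k + k - 1 \<le> n \<and> s k \<notin> A (s k + k - 1)"
      by (auto simp del: One_nat_def)
    have sD: "1 \<le> s k" "s k \<le> m + 1" "s k + k - 1 \<le> n" "s k \<notin> A (s k + k - 1)"
      if "k \<in> {1..n - m}" for k
      using s that by blast+
    have Sucn: "Suc n \<in> {1..p}" using Suc.prems by simp
    have step: "(\<forall>i\<in>{1..Suc n}. (c(Suc n := x)) i \<in> A i) \<and> restricted_growth (Suc n) (c(Suc n := x)) \<and>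
        (c(Suc n := x)) ` {1..Suc n} = {1..max m x}"
      if x: "x \<in> A (Suc n)" "x \<le> m + 1" for x
    proof (intro conjI)
      have "1 \<le> x" using A[OF Sucn] x by auto
      show "\<forall>i\<in>{1..Suc n}. (c(Suc n := x)) i \<in> A i" using c(1) x by auto
      show "restricted_growth (Suc n) (c(Suc n := x))"
        unfolding restricted_growth_def
      proof (intro ballI impI)
        fix i assume i: "i \<in> {1..Suc n}" "1 < (c(Suc n := x)) i"
        show "\<exists>k\<in>{1..<i}. (c(Suc n := x)) k = (c(Suc n := x)) i - 1"
        proof (cases "i = Suc n")
          case True
          then have "x - 1 \<in> c ` {1..n}" using i x c(3) by auto
          then obtain k where "k \<in> {1..n}" "c k = x - 1" by auto
          then show ?thesis using True by (intro bexI[of _ k]) auto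
        next
          case False
          then obtain k where "k \<in> {1..<i}" "c k = c i - 1"
            using restricted_growthD[OF c(2), of i] i by auto
          then show ?thesis using False i by (intro bexI[of _ k]) auto
        qed
      qed
      have "(c(Suc n := x)) ` {1..Suc n} = insert x (c ` {1..n})"
        by (auto simp: atLeastAtMostSuc_conv)
      also have "\<dots> = {1..max m x}" using \<open>1 \<le> x\<close> x unfolding c(3) by auto
      finally show "(c(Suc n := x)) ` {1..Suc n} = {1..max m x}" .
    qed
    show ?case
    proof (cases "m + 1 \<in> A (Suc n)")
      case True
      have "Suc n - (m + 1) = n - m" "max m (m + 1) = m + 1" by auto
      moreover have "\<forall>k\<in>{1..n - m}. 1 \<le> s k \<and> s k \<le> m + 1 + 1 \<and> s k + k - 1 \<le> Suc n \<and>
          s k \<notin> A (s k + k - 1)"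
        using sD le_SucI by (metis Suc_eq_plus1)
      ultimately show ?thesis
        using step[OF True] m mono
        by - (rule exI[of _ "c(Suc n := m + 1)"], rule exI[of _ "m + 1"], rule exI[of _ s],
            simp del: One_nat_def fun_upd_apply)
    next
      case False
      have "\<exists>x\<in>A (Suc n). x \<le> m"
      proof (rule ccontr)
        assume no: "\<not> ?thesis"
        then have ge: "m + 2 \<le> x" if "x \<in> A (Suc n)" for x
        proof -
          have "x \<noteq> m + 1" "\<not> x \<le> m" using that False no by metis+
          then show ?thesis by linarith
        qed
        obtain x where "x \<in> A (Suc n)" using ne[OF Sucn] by blast
        then have m2: "m + 2 \<le> q" "m + 2 \<le> Suc n" using ge[of x] A[OF Sucn] by auto
        define S where "S = (\<lambda>k. diag_coord k (s k)) ` {1..n - m}"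
        have "S \<subseteq> index_set p q"
          unfolding S_def
        proof (rule image_subsetI)
          fix k assume k: "k \<in> {1..n - m}"
          then show "diag_coord k (s k) \<in> index_set p q"
            using sD[OF k] m2 Suc.prems by (auto simp: diag_coord_def index_set_def)
        qed
        then have "shifted_column p q (n - m) s S"
          using mono m2 by (auto simp: shifted_column_def S_def)
        moreover have "s (n - m) < m + 2" 
        proof -
          have "n - m \<in> {1..n - m}" using m2 by simp
          from sD(2)[OF this] show ?thesis by simp
        qed
        \<comment> \<open>\<open>(Suc n, m + 2)\<close> lies on diagonal \<open>n - m\<close>,
          matching the length of \<open>s\<close>, which \<open>m2\<close> makes positive. By
          \<open>ge\<close> every choice from \<open>A\<close> hits the bar there, yet it avoids all
          positions of \<open>s\<close>.\<close>
        ultimately obtain d where d: "\<forall>i\<in>{1..p}. d i \<in> A i"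
          "m + 2 \<le> d (Suc n) \<longrightarrow> (\<exists>k\<in>{1..n - m}. d (s k + k - 1) = s k)"
          using sat[of "Suc n" "m + 2" "n - m" s S] m2 Suc.prems
          by (auto simp: index_set_def diag_coord_def)
        then obtain k where k: "k \<in> {1..n - m}" "d (s k + k - 1) = s k"
          using ge Sucn by blast
        then have "s k + k - 1 \<in> {1..p}" using sD(1,3)[OF k(1)] Suc.prems by auto
        then show False using d(1) k(2) sD(4)[OF k(1)] by metis
      qed
      then obtain x where x: "x \<in> A (Suc n)" "x \<le> m" by blast
      \<comment> \<open>Column \<open>m + 1\<close> on diagonal \<open>Suc n - m\<close> is in row
        \<open>Suc n\<close>, so this appends the newly blocked position. Monotonicity survives
        because earlier values are at most \<open>m + 1\<close>.\<close>
      let ?s = "s(Suc n - m := m + 1)"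
      have old: "k \<in> {1..n - m}" if "k \<in> {1..Suc n - m}" "k \<noteq> Suc n - m" for k
        using that by auto
      have "mono_on {1..Suc n - m} ?s"
      proof (rule mono_onI)
        fix k l assume kl: "k \<in> {1..Suc n - m}" "l \<in> {1..Suc n - m}" "k \<le> l"
        show "?s k \<le> ?s l"
        proof (cases "l = Suc n - m")
          case True
          then show ?thesis using sD(2)[OF old[OF kl(1)]] by (cases "k = l") auto
        next
          case False
          then have "k \<noteq> Suc n - m" using kl by auto
          then show ?thesis
            using False mono_onD[OF mono old[OF kl(1)] old[OF kl(2)] kl(3)] by simp
        qed
      qed
      moreover have "1 \<le> ?s k \<and> ?s k \<le> m + 1 \<and> ?s k + k - 1 \<le> Suc n \<and> ?s k \<notin> A (?s k + k - 1)"
        if k: "k \<in> {1..Suc n - m}" for k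
      proof (cases "k = Suc n - m")
        case True
        then have "m + 1 + k - 1 = Suc n" using m by simp
        then show ?thesis using True False by simp
      next
        case ne: False
        then show ?thesis using sD[OF old[OF k ne]] by simp
      qed
      moreover have "max m x = m" using x by simp
      ultimately show ?thesis
        using step[of x] x m
        by - (rule exI[of _ "c(Suc n := x)"], rule exI[of _ m], rule exI[of _ ?s],
            simp del: One_nat_def fun_upd_apply)
    qed
  qed
  from this[of p] show ?thesis by blast
qed

text \<open>Agreement on the chosen column settles a whole row, zeros included, and different rows
  may be matched by different points of \<open>X\<close>.\<close>

lemma choice_point_in_smallest_face:
  assumes c: "row_choice p q c" and X: "X \<subseteq> zero_one_points p q" "X \<noteq> {}"
    and rows: "\<And>i. i \<in> {1..p} \<Longrightarrow> \<exists>d. choice_point p d \<in> X \<and> d i = c i"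
  shows "choice_point p c \<in> smallest_face (cube p q) X"
proof (rule in_smallest_face_cube[OF X choice_point_zero_one[OF c]])
  fix e assume "e \<in> index_set p q"
  then obtain i j where e: "e = (i, j)" "i \<in> {1..p}" by (auto simp: index_set_def)
  then obtain d where "choice_point p d \<in> X" "d i = c i" using rows by blast
  then show "\<exists>x\<in>X. entry x e = entry (choice_point p c) e"
    by (intro bexI[of _ "choice_point p d"]) (simp_all add: e lookup_choice_point)
qed

section \<open>Stable faces are spanned by vertices of the orbitope\<close>

lemma zero_one_affine_hull_choice:
  assumes "x \<in> zero_one_points p q" "x \<in> affine hull orbitope p q"
  obtains c where "row_choice p q c" "x = choice_point p c"
  using zero_one_row_sum_choice[OF assms(1)] affine_hull_orbitope_row_sum[OF assms(2)] by blast

lemma fixed_face_subset_Fix_orbitope: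
  assumes pq: "1 \<le> p" and G: "G face_of cube p q"
    and fixed: "\<And>r. r \<in> SCI_system p q \<Longrightarrow>
      Fix p q G (solutions_in_cube p q r \<inter> affine hull orbitope p q) = G"
  shows "G \<subseteq> Fix p q G (orbitope p q)"
proof -
  define X where "X = {c. row_choice p q c \<and> choice_point p c \<in> G}"
  define Xr where "Xr = (\<lambda>r. {c \<in> X. choice_point p c \<in> solutions_in_cube p q r})"
  define A where "A = (\<lambda>i. (\<lambda>c. c i) ` X)"
  have G_eq: "G = smallest_face (cube p q) (choice_point p ` Xr r)" if r: "r \<in> SCI_system p q" for r
  proof -
    have "solutions_in_cube p q r \<inter> affine hull orbitope p q \<inter> G \<inter> zero_one_points p q
        = choice_point p ` Xr r" (is "?L = ?R")
    proof
      show "?L \<subseteq> ?R"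
      proof
        fix x assume x: "x \<in> ?L"
        then obtain c where "row_choice p q c" "x = choice_point p c"
          using zero_one_affine_hull_choice by blast
        then show "x \<in> ?R" using x by (auto simp: Xr_def X_def)
      qed
      show "?R \<subseteq> ?L"
        using choice_point_affine_hull choice_point_zero_one by (auto simp: Xr_def X_def)
    qed
    then show ?thesis using fixed[OF r] by (simp add: Fix_def)
  qed
  have Xr_zo: "choice_point p ` Xr r \<subseteq> zero_one_points p q" for r
    using choice_point_zero_one by (auto simp: Xr_def X_def)
  have growth: "\<exists>c\<in>X. c i = j \<and> restricted_growth p c" if i: "i \<in> {1..p}" and j: "j \<in> A i" for i j
  proof -
    \<comment> \<open>Allowed columns of different rows combine freely, since the face spanned by
      the choice points in \<open>G\<close> contains every combination.\<close>
    have X_if: "c \<in> X" if c: "\<And>k. k \<in> {1..p} \<Longrightarrow> c k \<in> A k" for c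
    proof -
      have rc: "row_choice p q c"
        unfolding row_choice_def
      proof
        fix k assume k: "k \<in> {1..p}"
        then obtain d where "row_choice p q d" "d k = c k" using c[OF k] by (auto simp: A_def X_def)
        then show "c k \<in> {1..min k q}" using k by (metis row_choice_def)
      qed
      have "choice_point p c \<in> smallest_face (cube p q) (choice_point p ` X)"
      proof (rule choice_point_in_smallest_face[OF rc])
        show "choice_point p ` X \<subseteq> zero_one_points p q"
          using choice_point_zero_one by (auto simp: X_def)
        show "choice_point p ` X \<noteq> {}" using j by (auto simp: A_def)
        fix k assume "k \<in> {1..p}"
        then show "\<exists>d. choice_point p d \<in> choice_point p ` X \<and> d k = c k"
          using c[of k] by (auto simp: A_def)
      qed
      also have "\<dots> \<subseteq> G" by (rule smallest_face_least[OF G]) (auto simp: X_def)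
      finally show ?thesis using rc by (simp add: X_def)
    qed
    \<comment> \<open>Otherwise coordinate \<open>(i, j)\<close> would vanish on
      \<open>Xr r\<close>, hence on the face it spans, which is \<open>G\<close> by stability; but
      some choice point of \<open>G\<close> has a 1 there.\<close>
    have sat: "\<exists>c\<in>Xr r. c i = j" if r: "r \<in> SCI_system p q" for r
    proof (rule ccontr)
      assume no: "\<not> ?thesis"
      obtain d where d: "d \<in> X" "d i = j" using j by (auto simp: A_def)
      then have ij: "(i, j) \<in> index_set p q"
        using i by (auto simp: X_def row_choice_def index_set_def)
      have "choice_point p d \<in> smallest_face (cube p q) (choice_point p ` Xr r)"
        using d G_eq[OF r] by (auto simp: X_def)
      then have "entry (choice_point p d) (i, j) = 0"
        by (rule smallest_face_coord[OF Xr_zo ij, rotated 2]) (use no in \<open>auto simp: lookup_choice_point\<close>)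
      then show False using d i by (simp add: lookup_choice_point)
    qed
    \<comment> \<open>Confining row \<open>i\<close> to \<open>j\<close> forces the growth function
      through the prescribed entry; \<open>sat\<close> provides choices that respect this
      confinement.\<close>
    let ?A = "A(i := {j})"
    have XA: "c k \<in> ?A k" if "c \<in> X" "c i = j" for c k
      using that by (auto simp: A_def)
    have "\<exists>c. (\<forall>k\<in>{1..p}. c k \<in> ?A k) \<and> restricted_growth p c"
    proof (rule restricted_growth_choice_exists[of p ?A q])
      obtain d where d: "d \<in> X" "d i = j" using j by (auto simp: A_def)
      fix k assume k: "k \<in> {1..p}"
      show "?A k \<noteq> {}" using XA[of d, OF d] by blast
      show "?A k \<subseteq> {1..min k q}"
        using k j by (auto simp: A_def X_def row_choice_def split: if_splits)
    next
      fix i' j' \<eta> s S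
      assume ij': "(i', j') \<in> index_set p q" "(i', j') = diag_coord \<eta> j'"
        and S: "shifted_column p q \<eta> s S" "s \<eta> < j'"
      let ?r = "(\<lambda>e. indicator (bar q i' j') e - indicator S e, 0) :: ineq"
      have "?r \<in> SCI_system p q"
        unfolding SCI_system_def shifted_column_ineqs_def using ij' S by blast
      from sat[OF this] obtain d where d: "d \<in> Xr ?r" "d i = j" by blast
      then have "row_choice p q d" "d \<in> X" by (auto simp: Xr_def X_def)
      then show "\<exists>c. (\<forall>k\<in>{1..p}. c k \<in> ?A k) \<and>
          (j' \<le> c i' \<longrightarrow> (\<exists>k\<in>{1..\<eta>}. c (s k + k - 1) = s k))"
        using d(1) choice_point_satisfies_SCI_iff[OF _ ij'(1) S(1)] XA[of d, OF _ d(2)]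
        by (intro exI[of _ d]) (simp add: Xr_def)
    qed
    then obtain c where c: "\<And>k. k \<in> {1..p} \<Longrightarrow> c k \<in> ?A k" "restricted_growth p c"
      by blast
    have "c k \<in> A k" if "k \<in> {1..p}" for k using c(1)[OF that] j by (auto split: if_splits)
    then show ?thesis using X_if c i by (intro bexI[of _ c]) (use c(1)[OF i] in auto)
  qed
  define V where "V = orbitope p q \<inter> G \<inter> zero_one_points p q"
  have growth_V: "choice_point p c \<in> V" if "c \<in> X" "restricted_growth p c" for c
    using that restricted_growth_orbitope_matrices choice_point_zero_one
    unfolding V_def orbitope_def X_def by (auto intro: hull_inc)
  \<comment> \<open>Any inequality of the system will do: it presents \<open>G\<close> as spanned by
    choice points.\<close>
  obtain r where r: "r \<in> SCI_system p q"
    using pq unfolding SCI_system_def row_sum_ineqs_def by force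
  have "choice_point p ` Xr r \<subseteq> smallest_face (cube p q) V"
  proof
    fix x assume "x \<in> choice_point p ` Xr r"
    then obtain c where c: "x = choice_point p c" "c \<in> X" by (auto simp: Xr_def)
    have rows: "\<exists>d. choice_point p d \<in> V \<and> d i = c i" if "i \<in> {1..p}" for i
      using growth[OF that, of "c i"] growth_V c(2) by (auto simp: A_def)
    show "x \<in> smallest_face (cube p q) V"
      unfolding c(1)
    proof (rule choice_point_in_smallest_face[OF _ _ _ rows])
      show "row_choice p q c" using c(2) by (simp add: X_def)
      show "V \<noteq> {}" using rows[of 1] pq by auto
    qed (auto simp: V_def)
  qed
  then have "smallest_face (cube p q) (choice_point p ` Xr r) \<subseteq> smallest_face (cube p q) V"
    unfolding V_def using zero_one_subset_cube[of p q]
    by (intro smallest_face_least smallest_face_face_of convex_cube) auto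
  then show ?thesis using G_eq[OF r] by (simp add: Fix_def V_def)
qed

text \<open>The iterated result is stable, so its own orbitope vertices span it. Conversely every
  relaxation contains the orbitope, so no step can cut into the face spanned by the vertices in
  \<open>F\<close>.\<close>

lemma Fix_system_aff_SCI_eq_Fix_orbitope:
  assumes "1 \<le> p" and F: "F face_of cube p q"
  shows "Fix_system_aff p q (affine hull orbitope p q) F (SCI_system p q) = Fix p q F (orbitope p q)"
    (is "?G = ?O")
proof
  have G: "?G face_of cube p q" "?G \<subseteq> F"
    unfolding Fix_system_aff_def by (rule fix_iter_face[OF F], rule fix_iter_subset[OF F])
  have "?G \<subseteq> Fix p q ?G (orbitope p q)"
  proof (rule fixed_face_subset_Fix_orbitope[OF assms(1) G(1)])
    fix r assume "r \<in> SCI_system p q"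
    then show "Fix p q ?G (solutions_in_cube p q r \<inter> affine hull orbitope p q) = ?G"
      unfolding Fix_system_aff_def by (intro fix_iter_fixed[OF F]) auto
  qed
  also have "\<dots> \<subseteq> ?O" by (rule Fix_mono[OF G(2)])
  finally show "?G \<subseteq> ?O" .
  show "?O \<subseteq> ?G"
    unfolding Fix_system_aff_def
  proof (rule fix_iter_greatest[OF F Fix_subset[OF F]])
    fix P assume "P \<in> (\<lambda>r. solutions_in_cube p q r \<inter> affine hull orbitope p q) ` SCI_system p q"
    then have "orbitope p q \<subseteq> P"
      using orbitope_subset_solutions hull_subset[of "orbitope p q" affine] by fast
    moreover have "orbitope p q \<inter> F \<inter> zero_one_points p q \<subseteq> ?O"
      unfolding Fix_def by (rule smallest_face_superset)
    ultimately show "?O \<subseteq> Fix p q ?O P"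
      unfolding Fix_def[of p q F] Fix_def[of p q _ P] by (intro smallest_face_mono) auto
  qed
qed

subsection \<open>Separating examples\<close>

abbreviation list_choice :: "nat list \<Rightarrow> nat \<Rightarrow> nat"
  where "list_choice xs \<equiv> \<lambda>i. xs ! (i - 1)"

lemma atLeastAtMost_1_4: "{1..4::nat} = {1, 2, 3, 4}" and atLeastAtMost_1_5: "{1..5::nat} = {1, 2, 3, 4, 5}"
  by auto

lemma smallest_face_subset_of_mem:
  assumes "X \<subseteq> smallest_face (cube p q) Y" "Y \<subseteq> zero_one_points p q"
  shows "smallest_face (cube p q) X \<subseteq> smallest_face (cube p q) Y"
  using assms zero_one_subset_cube[of p q]
  by (intro smallest_face_least smallest_face_face_of convex_cube) auto

text \<open>To check stability in the examples it is enough to exhibit points \<open>Y\<close> that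
  satisfy the constraint and span the generators \<open>X\<close>.\<close>

lemma subset_Fix_spanned:
  assumes "G = smallest_face (cube p q) X" "X \<subseteq> zero_one_points p q"
    and Y: "X \<subseteq> smallest_face (cube p q) Y" "Y \<subseteq> P \<inter> G \<inter> zero_one_points p q"
  shows "G \<subseteq> Fix p q G P"
proof -
  have "G \<subseteq> smallest_face (cube p q) Y"
    unfolding assms(1) by (rule smallest_face_subset_of_mem[OF Y(1)]) (use Y(2) in auto)
  also have "\<dots> \<subseteq> Fix p q G P"
    unfolding Fix_def by (rule smallest_face_mono[OF Y(2)])
  finally show ?thesis .
qed

lemma column_ineqsE:
  assumes "r \<in> column_ineqs p q"
  obtains i j \<eta> s S where "r = (\<lambda>e. indicator (bar q i j) e - indicator S e, 0)"
    "(i, j) \<in> index_set p q" "i = j + \<eta> - 1" "1 \<le> \<eta>" "2 \<le> j" "shifted_column p q \<eta> s S"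
    "\<And>k. k \<in> {1..\<eta>} \<Longrightarrow> s k = j - 1"
proof -
  obtain i j \<eta> s S where r: "r = (\<lambda>e. indicator (bar q i j) e - indicator S e, 0)"
    and ij: "(i, j) \<in> index_set p q" "(i, j) = diag_coord \<eta> j"
    and S: "shifted_column p q \<eta> s S" "s \<eta> < j" "\<forall>k\<in>{1..\<eta>}. s k = j - 1"
    using assms unfolding column_ineqs_def by blast
  have "1 \<le> \<eta>" using S(1) by (simp add: shifted_column_def)
  then have "1 \<le> s \<eta>" by (intro shifted_column_pos[OF S(1)]) simp
  then have "2 \<le> j" using S(2) by simp
  then show thesis using that[OF r ij(1) _ \<open>1 \<le> \<eta>\<close> _ S(1)] ij(2) S(3) by (simp add: diag_coord_def)
qed

lemma shifted_column_22_32: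
  assumes "2 \<le> q" "3 \<le> p"
  shows "shifted_column p q 2 (\<lambda>_. 2) {(2, 2), (3, 2)}"
proof -
  have "{1..2::nat} = {1, 2}" by auto
  then show ?thesis
    using assms by (auto simp: shifted_column_def diag_coord_def index_set_def mono_on_def)
qed

text \<open>The column 2 used here skips column 3, the one adjacent to the bar, so this is a shifted
  column inequality but not a column inequality.\<close>

lemma shifted_column_22_32_in_SCI:
  assumes "4 \<le> q" "5 \<le> p"
  shows "(\<lambda>e. indicator (bar q 5 4) e - indicator {(2, 2), (3, 2)} e, 0) \<in> shifted_column_ineqs p q"
  unfolding shifted_column_ineqs_def using assms shifted_column_22_32[of q p]
  by (intro CollectI exI[of _ 5] exI[of _ "4::nat"] exI[of _ "2::nat"] exI[of _ "\<lambda>_. 2::nat"]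
      exI[of _ "{(2, 2), (3, 2)}"]) (auto simp: diag_coord_def index_set_def)

text \<open>Write a choice of columns as a word. Every column inequality holds at \<open>11124\<close> or at \<open>11324\<close>,
  and either of them spans the same face together with \<open>12134\<close> and \<open>12324\<close>. But \<open>x\<^sub>5\<^sub>4 \<le> x\<^sub>2\<^sub>2 + x\<^sub>3\<^sub>2\<close> excludes both.\<close>

lemma SCI_stronger_than_CI:
  defines "T \<equiv> affine hull orbitope 5 4"
  obtains F where "F face_of cube 5 4"
    "Fix_system 5 4 F (SCI_system 5 4) \<subset> Fix_system 5 4 F (CI_system 5 4)"
    "Fix_system_aff 5 4 T F (SCI_system 5 4) \<subset> Fix_system_aff 5 4 T F (CI_system 5 4)"
proof -
  define g where "g = list_choice [1, 2, 1, 3, 4]"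
  define h where "h = list_choice [1, 2, 3, 2, 4]"
  define a where "a = list_choice [1, 1, 1, 2, 4]"
  define b where "b = list_choice [1, 1, 3, 2, 4]"
  \<comment> \<open>On \<open>F\<close> the columns allowed in rows 1 to 5 are {1}, {1,2}, {1,3},
    {2,3} and {4}; hence \<open>b\<close> lies in \<open>F\<close> as well.\<close>
  define F where "F = smallest_face (cube 5 4) (choice_point 5 ` {g, h, a})"
  have rc: "row_choice 5 4 c" if "c \<in> {g, h, a, b}" for c
    using that unfolding row_choice_def atLeastAtMost_1_5 by (auto simp: g_def h_def a_def b_def)
  have rg: "restricted_growth 5 c" if "c \<in> {g, h}" for c
  proof -
    have "restricted_growth 5 g"
      unfolding restricted_growth_def atLeastAtMost_1_5 g_def
      by (auto intro: bexI[of _ 1] bexI[of _ 2] bexI[of _ 4])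
    moreover have "restricted_growth 5 h"
      unfolding restricted_growth_def atLeastAtMost_1_5 h_def
      by (auto intro: bexI[of _ 1] bexI[of _ 2] bexI[of _ 3])
    ultimately show ?thesis using that by blast
  qed
  have zo: "choice_point 5 ` {g, h, a, b} \<subseteq> zero_one_points 5 4"
    using choice_point_zero_one rc by blast
  have F: "F face_of cube 5 4"
    unfolding F_def using zo zero_one_subset_cube[of 5 4]
    by (intro smallest_face_face_of convex_cube) auto
  have span: "choice_point 5 c \<in> smallest_face (cube 5 4) (choice_point 5 ` D)"
    if "c \<in> {g, h, a, b}" "D = {g, h, a} \<or> D = {g, h, b}" for c D
  proof (rule choice_point_in_smallest_face[OF rc[OF that(1)]])
    fix i :: nat assume "i \<in> {1..5}"
    then have "\<exists>d\<in>D. d i = c i"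
      using that unfolding atLeastAtMost_1_5 by (auto simp: g_def h_def a_def b_def)
    then show "\<exists>d. choice_point 5 d \<in> choice_point 5 ` D \<and> d i = c i" by blast
  qed (use that(2) zo in auto)
  have CI: "choice_point 5 a \<in> solutions_in_cube 5 4 r \<or> choice_point 5 b \<in> solutions_in_cube 5 4 r"
    if r: "r \<in> CI_system 5 4" for r
  proof (cases "r \<in> column_ineqs 5 4")
    case True
    then obtain i j \<eta> s S where r: "r = (\<lambda>e. indicator (bar 4 i j) e - indicator S e, 0)"
      and ij: "(i, j) \<in> index_set 5 4" "i = j + \<eta> - 1" "1 \<le> \<eta>" "2 \<le> j"
      and S: "shifted_column 5 4 \<eta> s S" and s: "\<And>k. k \<in> {1..\<eta>} \<Longrightarrow> s k = j - 1"
      by (rule column_ineqsE) blast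
    have sat: "(j \<le> c i \<longrightarrow> (\<exists>k\<in>{1..\<eta>}. c (j - 1 + k - 1) = j - 1)) \<Longrightarrow>
        choice_point 5 c \<in> solutions_in_cube 5 4 r" if "c \<in> {g, h, a, b}" for c
      unfolding r choice_point_satisfies_SCI_iff[OF rc[OF that] ij(1) S] using s by fastforce
    have "i \<in> {1..5}" "j \<in> {1..4}" "j \<le> i" using ij(1) by (auto simp: index_set_def)
    \<comment> \<open>\<open>a\<close> fails only at \<open>(5, 4)\<close>, where column 3 must be
      used in row 3 or 4; there \<open>b\<close> takes over, using it in row 3.\<close>
    then consider "i \<le> 3" | "i = 4" "j = 2" "\<eta> = 3" | "i = 4" "3 \<le> j" | "i = 5" "j = 2" "\<eta> = 4"
      | "i = 5" "j = 3" "\<eta> = 3" | "i = 5" "j = 4" "\<eta> = 2"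
      using ij by force
    then show ?thesis
    proof cases
      case 1
      then have "i = 1 \<or> i = 2 \<or> i = 3" using \<open>i \<in> {1..5}\<close> by auto
      then have "\<not> j \<le> a i" using ij(4) by (auto simp: a_def)
      then show ?thesis using sat[of a] by simp
    next
      case 2
      have "\<exists>k\<in>{1..\<eta>}. a (j - 1 + k - 1) = j - 1"
        unfolding 2 by (rule bexI[of _ 1]) (simp_all add: a_def)
      then show ?thesis using sat[of a] by blast
    next
      case 3
      then show ?thesis using sat[of a] by (simp add: a_def)
    next
      case 4
      have "\<exists>k\<in>{1..\<eta>}. a (j - 1 + k - 1) = j - 1"
        unfolding 4 by (rule bexI[of _ 1]) (simp_all add: a_def)
      then show ?thesis using sat[of a] by blast
    next
      case 5
      have "\<exists>k\<in>{1..\<eta>}. a (j - 1 + k - 1) = j - 1"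
        unfolding 5 by (rule bexI[of _ 3]) (simp_all add: a_def)
      then show ?thesis using sat[of a] by blast
    next
      case 6
      have "\<exists>k\<in>{1..\<eta>}. b (j - 1 + k - 1) = j - 1"
        unfolding 6 by (rule bexI[of _ 1]) (simp_all add: b_def)
      then show ?thesis using sat[of b] by blast
    qed
  next
    case False
    then show ?thesis using that choice_point_solves_basic[OF rc] by (auto simp: CI_system_def)
  qed
  have F_fix: "F \<subseteq> Fix 5 4 F (solutions_in_cube 5 4 r \<inter> T)" if r: "r \<in> CI_system 5 4" for r
  proof -
    obtain c where c: "c = a \<or> c = b" "choice_point 5 c \<in> solutions_in_cube 5 4 r"
      using CI[OF r] by blast
    have "choice_point 5 d \<in> solutions_in_cube 5 4 r" if "d \<in> {g, h}" for d
    proof -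
      have "r \<in> SCI_system 5 4"
        using r by (auto simp: CI_system_def SCI_system_def column_ineqs_def shifted_column_ineqs_def)
      then show ?thesis using restricted_growth_solves_SCI_system[OF rc rg] that by blast
    qed
    then have "choice_point 5 ` {g, h, c} \<subseteq> solutions_in_cube 5 4 r \<inter> T \<inter> F \<inter> zero_one_points 5 4"
      using c zo span[of _ "{g, h, a}"] choice_point_affine_hull[OF rc] by (auto simp: T_def F_def)
    moreover have "choice_point 5 ` {g, h, a} \<subseteq> smallest_face (cube 5 4) (choice_point 5 ` {g, h, c})"
      using span[of _ "{g, h, c}"] c(1) by blast
    ultimately show ?thesis
      using zo by (intro subset_Fix_spanned[OF F_def]) auto
  qed
  have CI_eq: "Fix_system_aff 5 4 T F (CI_system 5 4) = F"
    unfolding Fix_system_aff_def by (rule fix_iter_eq_self[OF F]) (use F_fix in auto)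
  have CI_eq': "Fix_system 5 4 F (CI_system 5 4) = F"
    unfolding Fix_system_def
  proof (rule fix_iter_eq_self[OF F])
    fix P assume "P \<in> solutions_in_cube 5 4 ` CI_system 5 4"
    then obtain r where r: "r \<in> CI_system 5 4" "P = solutions_in_cube 5 4 r" by blast
    have "Fix 5 4 F (solutions_in_cube 5 4 r \<inter> T) \<subseteq> Fix 5 4 F P"
      unfolding Fix_def r(2) by (rule smallest_face_mono) auto
    then show "F \<subseteq> Fix 5 4 F P" using F_fix[OF r(1)] by blast
  qed
  define r where "r = ((\<lambda>e. indicator (bar 4 5 4) e - indicator {(2, 2), (3, 2)} e, 0) :: ineq)"
  have r_SCI: "r \<in> SCI_system 5 4"
    unfolding r_def SCI_system_def by (intro UnI2 shifted_column_22_32_in_SCI) auto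
  \<comment> \<open>All generators of \<open>F\<close> have a 1 at \<open>(5, 4)\<close> and a 0 at
    \<open>(3, 2)\<close>, so the inequality leaves only \<open>(2, 2)\<close> to balance the
    bar.\<close>
  have x22: "entry x (2, 2) = 1" if x: "x \<in> solutions_in_cube 5 4 r \<inter> F \<inter> zero_one_points 5 4" for x
  proof -
    have x54: "entry x (5, 4) = 1"
      by (rule smallest_face_coord[of "choice_point 5 ` {g, h, a}" 5 4])
        (use x zo in \<open>auto simp: F_def index_set_def lookup_choice_point g_def h_def a_def\<close>)
    have x32: "entry x (3, 2) = 0"
      by (rule smallest_face_coord[of "choice_point 5 ` {g, h, a}" 5 4])
        (use x zo in \<open>auto simp: F_def index_set_def lookup_choice_point g_def h_def a_def\<close>)
    have bar: "bar 4 5 4 = {(5, 4)}" by (auto simp: bar_def)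
    have "(\<Sum>e\<in>bar 4 5 4. entry x e) \<le> (\<Sum>e\<in>{(2, 2), (3, 2)}. entry x e)"
      using x unfolding r_def by (intro solutions_in_cube_le[of x 5 4]) (auto simp: bar index_set_def)
    then have "1 \<le> entry x (2, 2)" using x54 x32 by (simp add: bar)
    moreover have "entry x (2, 2) \<in> {0, 1}"
      using x by (auto simp: zero_one_points_def index_set_def)
    ultimately show ?thesis by auto
  qed
  \<comment> \<open>Leaving \<open>P\<close> arbitrary covers the iteration both with and without
    the affine hull.\<close>
  have smaller: "Fix 5 4 F P \<subset> F" if P: "P \<subseteq> solutions_in_cube 5 4 r" for P
  proof -
    have "choice_point 5 a \<notin> Fix 5 4 F P"
    proof
      assume "choice_point 5 a \<in> Fix 5 4 F P"
      then have "entry (choice_point 5 a) (2, 2) = 1"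
        unfolding Fix_def
        by (rule smallest_face_coord[rotated 4]) (use x22 P in \<open>auto simp: index_set_def\<close>)
      then show False by (simp add: lookup_choice_point a_def)
    qed
    moreover have "choice_point 5 a \<in> F" using span[of a "{g, h, a}"] by (simp add: F_def)
    ultimately show ?thesis using Fix_subset[OF F] by blast
  qed
  have "Fix_system 5 4 F (SCI_system 5 4) \<subset> F"
    using fix_iter_subset_Fix[OF F imageI[OF r_SCI], of "solutions_in_cube 5 4"] smaller[OF order.refl]
    unfolding Fix_system_def by blast
  moreover have "Fix_system_aff 5 4 T F (SCI_system 5 4) \<subset> F"
    using fix_iter_subset_Fix[OF F imageI[OF r_SCI], of "\<lambda>r. solutions_in_cube 5 4 r \<inter> T"]
      smaller[of "solutions_in_cube 5 4 r \<inter> T"]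
    unfolding Fix_system_aff_def by blast
  ultimately show thesis using that[OF F] CI_eq CI_eq' by simp
qed

section \<open>Column inequalities within the affine hull against separate shifted column
  inequalities\<close>

lemma column_22_32_in_CI_system:
  "(\<lambda>e. indicator (bar 4 4 3) e - indicator {(2, 2), (3, 2)} e, 0) \<in> CI_system 4 4"
  unfolding CI_system_def column_ineqs_def using shifted_column_22_32[of 4 4]
  by (intro UnI2 CollectI exI[of _ 4] exI[of _ "3::nat"] exI[of _ "2::nat"] exI[of _ "\<lambda>_. 2::nat"]
      exI[of _ "{(2, 2), (3, 2)}"]) (auto simp: diag_coord_def index_set_def)

text \<open>Row 4 is confined to columns 3 and 4. Only together with its row-sum equation does
  \<open>x\<^sub>4\<^sub>3 + x\<^sub>4\<^sub>4 \<le> x\<^sub>2\<^sub>2 + x\<^sub>3\<^sub>2\<close> fix \<open>x\<^sub>2\<^sub>2\<close>: the point \<open>y\<close> with an empty row 4 satisfies all shifted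
  column inequalities, and \<open>1113\<close> satisfies the row-sum equations.\<close>

lemma affine_CI_stronger_than_SCI:
  defines "T \<equiv> affine hull orbitope 4 4"
  obtains F where "F face_of cube 4 4"
    "Fix_system_aff 4 4 T F (CI_system 4 4) \<subset> Fix_system 4 4 F (SCI_system 4 4)"
proof -
  define g where "g = list_choice [1, 2, 1, 3]"
  define h where "h = list_choice [1, 2, 3, 4]"
  define b where "b = list_choice [1, 1, 1, 3]"
  define y where "y = ind_point {(1, 1), (2, 1), (3, 1)}"
  define X where "X = {choice_point 4 g, choice_point 4 h, y}"
  define F where "F = smallest_face (cube 4 4) X"
  have rc: "row_choice 4 4 c" if "c \<in> {g, h, b}" for c
    using that unfolding row_choice_def atLeastAtMost_1_4 by (auto simp: g_def h_def b_def)
  have rg: "restricted_growth 4 c" if "c \<in> {g, h}" for c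
  proof -
    have "restricted_growth 4 g"
      unfolding restricted_growth_def atLeastAtMost_1_4 g_def
      by (auto intro: bexI[of _ 1] bexI[of _ 2])
    moreover have "restricted_growth 4 h"
      unfolding restricted_growth_def atLeastAtMost_1_4 h_def
      by (auto intro: bexI[of _ 1] bexI[of _ 2] bexI[of _ 3])
    ultimately show ?thesis using that by blast
  qed
  have y_entry: "entry y (i, j) = (if i \<in> {1..3} \<and> j = 1 then 1 else 0)" for i j
    by (auto simp: y_def lookup_ind_point indicator_def)
  have zo: "choice_point 4 ` {g, h, b} \<subseteq> zero_one_points 4 4" "y \<in> zero_one_points 4 4"
    using choice_point_zero_one rc unfolding y_def
    by (blast, intro ind_point_zero_one) (auto simp: index_set_def)
  have X_zo: "X \<subseteq> zero_one_points 4 4" using zo by (auto simp: X_def)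
  have F: "F face_of cube 4 4"
    unfolding F_def using X_zo zero_one_subset_cube[of 4 4]
    by (intro smallest_face_face_of convex_cube) auto
  have idx: "(i = 1 \<or> i = 2 \<or> i = 3 \<or> i = 4) \<and> 1 \<le> j \<and> j \<le> 4" if "(i, j) \<in> index_set 4 4" for i j
    using that by (auto simp: index_set_def)
  \<comment> \<open>\<open>b\<close> agrees with \<open>y\<close> in rows 1 to 3 and with
    \<open>g\<close> in row 4.\<close>
  have b_F: "choice_point 4 b \<in> F"
    unfolding F_def
  proof (rule in_smallest_face_cube[OF X_zo])
    show "choice_point 4 b \<in> zero_one_points 4 4" using zo by simp
    fix e assume "e \<in> index_set 4 4"
    moreover obtain i j where e: "e = (i, j)" by fastforce
    ultimately have "i = 1 \<or> i = 2 \<or> i = 3 \<or> i = 4" using idx by blast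
    then show "\<exists>x\<in>X. entry x e = entry (choice_point 4 b) e"
      by (auto simp: X_def e y_entry lookup_choice_point b_def g_def)
  qed (simp add: X_def)
  \<comment> \<open>Rows 1 to 3 of \<open>y\<close> agree with \<open>b\<close>. The zeros of row 4
    are attained separately: \<open>(4, 3)\<close> by \<open>h\<close>, \<open>(4, 4)\<close> by
    \<open>g\<close>.\<close>
  have y_span: "y \<in> smallest_face (cube 4 4) (choice_point 4 ` {g, h, b})"
  proof (rule in_smallest_face_cube[OF zo(1) _ zo(2)])
    fix e assume "e \<in> index_set 4 4"
    moreover obtain i j where e: "e = (i, j)" by fastforce
    ultimately have "i = 1 \<or> i = 2 \<or> i = 3 \<or> i = 4" using idx by blast
    then show "\<exists>x\<in>choice_point 4 ` {g, h, b}. entry x e = entry y e"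
      by (auto simp: e y_entry lookup_choice_point b_def g_def h_def)
  qed simp
  \<comment> \<open>All bars start in column 2 or later, while \<open>y\<close> occupies only column
    1.\<close>
  have y_sol: "y \<in> solutions_in_cube 4 4 r" if r: "r \<in> nonneg_ineqs 4 4 \<union> shifted_column_ineqs 4 4" for r
  proof (cases "r \<in> nonneg_ineqs 4 4")
    case True
    then show ?thesis using solutions_nonneg zo(2) zero_one_subset_cube by blast
  next
    case False
    then obtain i j \<eta> s S where r_eq: "r = (\<lambda>e. indicator (bar 4 i j) e - indicator S e, 0)"
      and ij: "(i, j) \<in> index_set 4 4" and S: "shifted_column 4 4 \<eta> s S" "s \<eta> < j"
      using r unfolding shifted_column_ineqs_def by blast
    have "1 \<le> s \<eta>" using S(1) by (intro shifted_column_pos[OF S(1)]) (simp add: shifted_column_def)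
    then have "2 \<le> j" using S(2) by simp
    then have "(\<Sum>e\<in>bar 4 i j. entry y e) = 0"
      by (intro sum.neutral) (auto simp: bar_def y_entry)
    also have "0 \<le> (\<Sum>e\<in>S. entry y e)" by (intro sum_nonneg) (auto simp: y_entry)
    finally show ?thesis
      unfolding r_eq using solutions_in_cube_pair_iff[OF bar_subset[OF ij]] S(1) zo(2) zero_one_subset_cube[of 4 4]
      by (auto simp: shifted_column_def)
  qed
  \<comment> \<open>Each inequality is handled alone, so the third spanning point may vary:
    \<open>b\<close> for row sums, \<open>y\<close> for all others.\<close>
  have SCI: "F \<subseteq> Fix 4 4 F (solutions_in_cube 4 4 r)" if r: "r \<in> SCI_system 4 4" for r
  proof -
    have gh: "choice_point 4 ` {g, h} \<subseteq> solutions_in_cube 4 4 r"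
      using restricted_growth_solves_SCI_system[OF rc rg r] by blast
    have X_F: "X \<subseteq> F" unfolding F_def by (rule smallest_face_superset)
    show ?thesis
    proof (cases "r \<in> row_sum_ineqs 4 4")
      case True
      then have "choice_point 4 b \<in> solutions_in_cube 4 4 r"
        by (intro choice_point_solves_basic rc) auto
      then have "choice_point 4 ` {g, h, b} \<subseteq> solutions_in_cube 4 4 r \<inter> F \<inter> zero_one_points 4 4"
        using gh b_F X_F zo by (auto simp: X_def)
      moreover have "X \<subseteq> smallest_face (cube 4 4) (choice_point 4 ` {g, h, b})"
        using y_span smallest_face_superset[of "choice_point 4 ` {g, h, b}"] by (auto simp: X_def)
      ultimately show ?thesis by (intro subset_Fix_spanned[OF F_def X_zo])
    next
      case False
      then have "X \<subseteq> solutions_in_cube 4 4 r \<inter> F \<inter> zero_one_points 4 4"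
        using r gh y_sol X_F X_zo by (auto simp: SCI_system_def X_def)
      then show ?thesis by (intro subset_Fix_spanned[OF F_def X_zo smallest_face_superset])
    qed
  qed
  have SCI_eq: "Fix_system 4 4 F (SCI_system 4 4) = F"
    unfolding Fix_system_def by (rule fix_iter_eq_self[OF F]) (use SCI in auto)
  define r where "r = ((\<lambda>e. indicator (bar 4 4 3) e - indicator {(2, 2), (3, 2)} e, 0) :: ineq)"
  have r_CI: "r \<in> CI_system 4 4" unfolding r_def by (rule column_22_32_in_CI_system)
  let ?P = "solutions_in_cube 4 4 r \<inter> T"
  have x22: "entry x (2, 2) = 1" if x: "x \<in> ?P \<inter> F \<inter> zero_one_points 4 4" for x
  proof -
    \<comment> \<open>The affine hull enters here: \<open>x\<close> is a choice point, so row 4,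
      excluded from columns 1 and 2 on \<open>F\<close>, must hit the bar. With
      \<open>(3, 2)\<close> zero on \<open>F\<close>, only \<open>(2, 2)\<close> can balance
      it.\<close>
    obtain c where c: "row_choice 4 4 c" "x = choice_point 4 c"
      using zero_one_affine_hull_choice x unfolding T_def by blast
    have x0: "entry x e = 0" if "e \<in> {(3, 2), (4, 1), (4, 2)}" for e
      by (rule smallest_face_coord[OF X_zo, of e])
        (use x that in \<open>auto simp: F_def X_def index_set_def y_entry lookup_choice_point g_def h_def\<close>)
    have "c 4 \<noteq> 1" "c 4 \<noteq> 2" using x0[of "(4, 1)"] x0[of "(4, 2)"] by (auto simp: c(2) lookup_choice_point)
    moreover have "1 \<le> c 4" using c(1) by (auto simp: row_choice_def)
    ultimately have "(\<Sum>e\<in>bar 4 4 3. entry x e) = 1"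
      unfolding c(2) by (subst sum_bar_choice_point[OF c(1)]) auto
    moreover have "(\<Sum>e\<in>bar 4 4 3. entry x e) \<le> (\<Sum>e\<in>{(2, 2), (3, 2)}. entry x e)"
      using x unfolding r_def by (intro solutions_in_cube_le[of x 4 4]) (auto simp: bar_def index_set_def)
    ultimately have "1 \<le> entry x (2, 2)" using x0[of "(3, 2)"] by simp
    then show ?thesis by (simp add: c(2) lookup_choice_point split: if_splits)
  qed
  have "y \<notin> Fix 4 4 F ?P"
  proof
    assume "y \<in> Fix 4 4 F ?P"
    then have "entry y (2, 2) = 1"
      unfolding Fix_def by (rule smallest_face_coord[rotated 4]) (use x22 in \<open>auto simp: index_set_def\<close>)
    then show False by (simp add: y_entry)
  qed
  moreover have "y \<in> F" unfolding F_def using smallest_face_superset[of X] by (auto simp: X_def)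
  moreover have "Fix 4 4 F ?P \<subseteq> F" by (rule Fix_subset[OF F])
  moreover have "Fix_system_aff 4 4 T F (CI_system 4 4) \<subseteq> Fix 4 4 F ?P"
    unfolding Fix_system_aff_def using r_CI by (intro fix_iter_subset_Fix[OF F]) auto
  ultimately show thesis using that[OF F] SCI_eq by blast
qed

theorem theorem3:
  shows "(\<exists>p q F1. 2 \<le> q \<and> q \<le> p \<and> F1 face_of cube p q \<and>
            Fix_system p q F1 (SCI_system p q) \<subset> Fix_system p q F1 (CI_system p q)) \<and>
         (\<exists>p q F2. 2 \<le> q \<and> q \<le> p \<and> F2 face_of cube p q \<and>
            Fix_system_aff p q (affine hull (orbitope p q)) F2 (CI_system p q)
              \<subset> Fix_system p q F2 (SCI_system p q)) \<and>
         (\<exists>p q F3. 2 \<le> q \<and> q \<le> p \<and> F3 face_of cube p q \<and>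
            Fix_system_aff p q (affine hull (orbitope p q)) F3 (SCI_system p q)
              \<subset> Fix_system_aff p q (affine hull (orbitope p q)) F3 (CI_system p q)) \<and>
         (\<forall>p q F. 2 \<le> q \<longrightarrow> q \<le> p \<longrightarrow> F face_of cube p q \<longrightarrow>
            Fix_system_aff p q (affine hull (orbitope p q)) F (SCI_system p q)
              = Fix p q F (orbitope p q))"
proof (intro conjI allI impI)
  obtain F where F: "F face_of cube 5 4"
    "Fix_system 5 4 F (SCI_system 5 4) \<subset> Fix_system 5 4 F (CI_system 5 4)"
    "Fix_system_aff 5 4 (affine hull (orbitope 5 4)) F (SCI_system 5 4)
      \<subset> Fix_system_aff 5 4 (affine hull (orbitope 5 4)) F (CI_system 5 4)"
    by (rule SCI_stronger_than_CI)
  have "(2::nat) \<le> 4" "(4::nat) \<le> 5" by auto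
  with F show "\<exists>p q F1. 2 \<le> q \<and> q \<le> p \<and> F1 face_of cube p q \<and>
      Fix_system p q F1 (SCI_system p q) \<subset> Fix_system p q F1 (CI_system p q)"
    and "\<exists>p q F3. 2 \<le> q \<and> q \<le> p \<and> F3 face_of cube p q \<and>
      Fix_system_aff p q (affine hull (orbitope p q)) F3 (SCI_system p q)
        \<subset> Fix_system_aff p q (affine hull (orbitope p q)) F3 (CI_system p q)"
    by blast+
next
  obtain F where "F face_of cube 4 4"
    "Fix_system_aff 4 4 (affine hull (orbitope 4 4)) F (CI_system 4 4)
      \<subset> Fix_system 4 4 F (SCI_system 4 4)"
    by (rule affine_CI_stronger_than_SCI)
  moreover have "(2::nat) \<le> 4" "(4::nat) \<le> 4" by auto
  ultimately show "\<exists>p q F2. 2 \<le> q \<and> q \<le> p \<and> F2 face_of cube p q \<and>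
      Fix_system_aff p q (affine hull (orbitope p q)) F2 (CI_system p q)
        \<subset> Fix_system p q F2 (SCI_system p q)"
    by blast
next
  fix p q F assume "2 \<le> q" "q \<le> p" "F face_of cube p q"
  then show "Fix_system_aff p q (affine hull (orbitope p q)) F (SCI_system p q)
      = Fix p q F (orbitope p q)"
    by (intro Fix_system_aff_SCI_eq_Fix_orbitope) auto
qed

end
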